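(* Let $m,n\in\mathbb{R}$ with $m^2+n^2\neq0$ and let $e_1^{mn}=(m,n,0,0,0)\in\mathbb{R}^5$. Consider the controlled fractional $5D$ Maxwell-Bloch system with $x_e=e_1^{mn}$ and real parameters $k_1,\dots,k_5\ge 0$, i.e. $$D_t^{\alpha}x^1=x^3-k_1(x^1-m),\quad D_t^{\alpha}x^2=x^4-k_2(x^2-n),\quad D_t^{\alpha}x^3=x^1x^5-k_3x^3,$$ $$D_t^{\alpha}x^4=x^2x^5-k_4x^4,\quad D_t^{\alpha}x^5=-(x^1x^3+x^2x^4)-k_5x^5,$$ and its equilibrium state $e_1^{mn}$. Put $$a_1=k_3+k_4+k_5,\quad a_2=k_3k_4+k_3k_5+k_4k_5+m^2+n^2,\quad a_3=k_3k_4k_5+k_3n^2+k_4m^2,$$ and let $$D(P)=18a_1a_2a_3+a_1^2a_2^2-4a_3a_1^3-4a_2^3-27a_3^2$$ be the discriminant of $P(\lambda)=\lambda^3+a_1\lambda^2+a_2\lambda+a_3$. (i) Let $k_i>0$ for $i=1,\dots,5$. (1) If $D(P)>0$, then $e_1^{mn}$ is locally asymptotically stable for $\alpha\in(0,1)$. (2) If $D(P)<0$, then $e_1^{mn}$ is locally asymptotically stable for $\alpha\in(0,\frac23)$. (ii) Let $k_1>0$, $k_2>0$, $k_3=k_4=b>0$, $k_5=0$. (1) If $b>2\sqrt{m^2+n^2}$, then $e_1^{mn}$ is locally asymptotically stable for $\alpha\in(0,1)$. (2) If $0<b<2\sqrt{m^2+n^2}$, then $e_1^{mn}$ is locally asymptotically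 stable for $\alpha\in(0,\frac23)$.
   Context: $D_t^{\alpha}$ denotes the Caputo fractional derivative of order $\alpha\in(0,1)$ with base point $0$, $D_t^{\alpha}f=J^{1-\alpha}f'$, where $J^{\beta}f(t)=\frac{1}{\Gamma(\beta)}\int_0^t(t-s)^{\beta-1}f(s)\,ds$. Superscripts on $x$ denote components. An initial value problem $D_t^\alpha x=f(x)$, $x(0)=x_0$ is understood through the equivalent Volterra equation $x(t)=x_0+\frac{1}{\Gamma(\alpha)}\int_0^t(t-s)^{\alpha-1}f(x(s))\,ds$ with $x$ continuous. An equilibrium state is a zero of the right-hand side. An equilibrium state $x_e$ is locally asymptotically stable if it is Lyapunov stable (for every $\varepsilon>0$ there is $\delta>0$ such that $\|x(0)-x_e\|<\delta$ implies $\|x(t)-x_e\|<\varepsilon$ for all $t\ge0$) and there is $\delta_0>0$ such that $\|x(0)-x_e\|<\delta_0$ implies $\lim_{t\to\infty}\|x(t)-x_e\|=0$. *)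

theory Defs
  imports "HOL-Analysis.Analysis"
begin

text \<open>
  Riemann--Liouville fractional integral of order \<open>\<beta> > 0\<close> with base point \<open>0\<close>.
  The kernel is singular at \<open>s = t\<close> when \<open>\<beta> < 1\<close>; there \<open>0 powr (\<beta> - 1) = 0\<close>, which
  does not affect the integral.
\<close>

definition RL_integral :: "real \<Rightarrow> (real \<Rightarrow> 'a::euclidean_space) \<Rightarrow> real \<Rightarrow> 'a" where
  "RL_integral \<beta> g t =
     (1 / Gamma \<beta>) *\<^sub>R integral {0..t} (\<lambda>s. (t - s) powr (\<beta> - 1) *\<^sub>R g s)"

text \<open>
  Solution on \<open>[0, \<infinity>)\<close> of the Caputo initial value problem \<open>D\<^sup>\<alpha> x = f(x)\<close>, \<open>x(0) = x0\<close>, in the sense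
  of the equivalent Volterra equation. The values of \<open>x\<close> at negative times are irrelevant.
\<close>

definition caputo_ivp_solution ::
    "real \<Rightarrow> ('a::euclidean_space \<Rightarrow> 'a) \<Rightarrow> 'a \<Rightarrow> (real \<Rightarrow> 'a) \<Rightarrow> bool" where
  "caputo_ivp_solution \<alpha> f x0 x \<longleftrightarrow>
     continuous_on {0..} x \<and>
     (\<forall>t\<ge>0. x t = x0 + RL_integral \<alpha> (\<lambda>s. f (x s)) t)"

definition equilibrium_state :: "('a::euclidean_space \<Rightarrow> 'a) \<Rightarrow> 'a \<Rightarrow> bool" where
  "equilibrium_state f xe \<longleftrightarrow> f xe = 0"

text \<open>
  The bounds ``for all \<open>t \<ge> 0\<close>'' and the limit \<open>t \<rightarrow> \<infinity>\<close> presuppose that the solution exists for all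
  times. This is demanded explicitly for every admissible initial state, so that neither condition
  can hold vacuously.
\<close>

definition lyapunov_stable :: "real \<Rightarrow> ('a::euclidean_space \<Rightarrow> 'a) \<Rightarrow> 'a \<Rightarrow> bool" where
  "lyapunov_stable \<alpha> f xe \<longleftrightarrow>
     (\<forall>\<epsilon>>0. \<exists>\<delta>>0. \<forall>x0. norm (x0 - xe) < \<delta> \<longrightarrow>
        (\<exists>x. caputo_ivp_solution \<alpha> f x0 x) \<and>
        (\<forall>x. caputo_ivp_solution \<alpha> f x0 x \<longrightarrow> (\<forall>t\<ge>0. norm (x t - xe) < \<epsilon>)))"

definition locally_attractive :: "real \<Rightarrow> ('a::euclidean_space \<Rightarrow> 'a) \<Rightarrow> 'a \<Rightarrow> bool" where
  "locally_attractive \<alpha> f xe \<longleftrightarrow>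
     (\<exists>\<delta>0>0. \<forall>x0. norm (x0 - xe) < \<delta>0 \<longrightarrow>
        (\<exists>x. caputo_ivp_solution \<alpha> f x0 x) \<and>
        (\<forall>x. caputo_ivp_solution \<alpha> f x0 x \<longrightarrow> ((\<lambda>t. norm (x t - xe)) \<longlongrightarrow> 0) at_top))"

definition locally_asymptotically_stable ::
    "real \<Rightarrow> ('a::euclidean_space \<Rightarrow> 'a) \<Rightarrow> 'a \<Rightarrow> bool" where
  "locally_asymptotically_stable \<alpha> f xe \<longleftrightarrow>
     equilibrium_state f xe \<and> lyapunov_stable \<alpha> f xe \<and> locally_attractive \<alpha> f xe"

definition e1 :: "real \<Rightarrow> real \<Rightarrow> real ^ 5" where
  "e1 m n = vector [m, n, 0, 0, 0]"

text \<open>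
  Right-hand side of the 5D Maxwell--Bloch system with the linear feedback
  \<open>- k\<^sub>i (x\<^sup>i - x\<^sub>e\<^sup>i)\<close> added to the \<open>i\<close>-th component, for \<open>x\<^sub>e = e1 m n\<close>.
\<close>

definition controlled_maxwell_bloch ::
    "real \<Rightarrow> real \<Rightarrow> real \<Rightarrow> real \<Rightarrow> real \<Rightarrow> real \<Rightarrow> real \<Rightarrow> real ^ 5 \<Rightarrow> real ^ 5" where
  "controlled_maxwell_bloch m n k1 k2 k3 k4 k5 x = vector
     [x$3 - k1 * (x$1 - m),
      x$4 - k2 * (x$2 - n),
      x$1 * x$5 - k3 * x$3,
      x$2 * x$5 - k4 * x$4,
      - (x$1 * x$3 + x$2 * x$4) - k5 * x$5]"

text \<open>Discriminant of the monic cubic \<open>\<lambda>\<^sup>3 + a1 \<lambda>\<^sup>2 + a2 \<lambda> + a3\<close>.\<close>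

definition cubic_discriminant :: "real \<Rightarrow> real \<Rightarrow> real \<Rightarrow> real" where
  "cubic_discriminant a1 a2 a3 =
     18 * a1 * a2 * a3 + a1^2 * a2^2 - 4 * a3 * a1^3 - 4 * a2^3 - 27 * a3^2"

end

theory Submission
  imports Defs
begin

text \<open>
  Let \<open>k(t) = t\<^bsup>\<alpha>-1\<^esup> / \<Gamma>(\<alpha>)\<close>. There is an explicit nonnegative kernel \<open>\<mu>\<close> of total mass \<open>1\<close> such that
  \<open>p = k - \<mu> * k\<close> satisfies \<open>0 < p \<le> \<tau> \<mu>\<close>, with \<open>\<tau> > 0\<close> as small as desired. With \<open>R(t) = \<integral>\<^sub>0\<^sup>t \<mu>\<close>, the
  Volterra equation \<open>x = x\<^sub>0 + k * f(x)\<close> is equivalent to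
  \<open>x = (1 - R) x\<^sub>0 + \<mu> * x + p * f(x)\<close>, which exhibits \<open>x(t)\<close> as an average of \<open>x\<^sub>0\<close> and of explicit
  Euler steps \<open>x(s) + h f(x(s))\<close> with \<open>0 \<le> h \<le> \<tau>\<close>. If the short Euler steps contract a ball around the
  equilibrium, then the averaged equation defines a contraction of the continuous functions into that ball
  (existence), no solution leaves the ball, and \<open>limsup |x|\<close> is at most \<open>q < 1\<close> times itself
  (attractivity).

  Near an equilibrium the Euler steps contract as soon as the linearization has a strict quadratic
  Lyapunov function \<open>|L d|\<^sup>2\<close>. The last three equations of the linearized Maxwell--Bloch system form a
  skew-symmetric system with damping \<open>k\<^sub>3, k\<^sub>4, k\<^sub>5\<close>, so the energy is such a function when all three are
  positive. When \<open>k\<^sub>5 = 0\<close> a small cross term transfers damping to the fifth component.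
\<close>

section \<open>Beta integrals\<close>

text \<open>The change of variables \<open>z = g s\<close> for increasing \<open>g\<close>. It is
  carried out on open intervals, away from the endpoint singularities of the Beta integrand; the
  endpoints are null and are restored at the end.\<close>

lemma beta_substitution:
  fixes a b :: real and g g' f :: "real \<Rightarrow> real"
  assumes ab: "a > 0" "b > 0" and w: "0 < w" "w \<le> 1"
    and der: "\<And>s. s \<in> {0<..<t} \<Longrightarrow> (g has_field_derivative g' s) (at s within {0<..<t})"
    and pos: "\<And>s. s \<in> {0<..<t} \<Longrightarrow> g' s > 0"
    and bij: "inj_on g {0<..<t}" "g ` {0<..<t} = {0<..<w}"
    and eq: "\<And>s. s \<in> {0<..<t} \<Longrightarrow> f s = g' s * (g s powr (a - 1) * (1 - g s) powr (b - 1))"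
  shows "(f has_integral integral {0..w} (\<lambda>z. z powr (a - 1) * (1 - z) powr (b - 1))) {0..t}"
proof -
  let ?h = "\<lambda>z::real. z powr (a - 1) * (1 - z) powr (b - 1)"
  have "?h integrable_on {0..w}"
    using integrable_on_subinterval[OF integrable_Beta'[OF ab], of 0 w] w by auto
  then have I: "?h integrable_on {0<..<w}" "integral {0<..<w} ?h = integral {0..w} ?h"
    by (auto simp: integrable_on_Icc_iff_Ioo integral_open_interval_real)
  have "?h absolutely_integrable_on {0<..<w}"
    by (rule nonnegative_absolutely_integrable_1[OF I(1)]) auto
  then have "(\<lambda>s. \<bar>g' s\<bar> * ?h (g s)) absolutely_integrable_on {0<..<t} \<and>
      integral {0<..<t} (\<lambda>s. \<bar>g' s\<bar> * ?h (g s)) = integral {0<..<w} ?h"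
    using has_absolute_integral_change_of_variables_1'[OF _ der bij(1), of ?h] bij(2) by simp
  then have "((\<lambda>s. \<bar>g' s\<bar> * ?h (g s)) has_integral integral {0..w} ?h) {0<..<t}"
    using I(2) set_lebesgue_integral_eq_integral(1) integrable_integral by fastforce
  then have "(f has_integral integral {0..w} ?h) {0<..<t}"
    by (rule has_integral_eq[rotated]) (use eq pos in \<open>auto simp: abs_of_pos\<close>)
  then show ?thesis by (simp add: has_integral_Icc_iff_Ioo)
qed

text \<open>The Moebius map \<open>g s = s * (\<sigma> + t) / (t * (\<sigma> + s))\<close> sends the
  interval from \<open>0\<close> to \<open>t\<close> onto that from \<open>0\<close> to
  \<open>1\<close>, and \<open>1 - g s\<close> is proportional to
  \<open>(t - s) / (\<sigma> + s)\<close>. The three factors thus become the Beta integrand, up to a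
  constant.\<close>

lemma has_integral_beta_prime_conv:
  fixes a b \<sigma> t :: real
  assumes "a > 0" "b > 0" "\<sigma> > 0" "t > 0"
  shows "((\<lambda>s. s powr (a - 1) * (\<sigma> + s) powr (- a - b) * (t - s) powr (b - 1)) has_integral
    Beta a b * t powr (a + b - 1) * \<sigma> powr (- b) * (\<sigma> + t) powr (- a)) {0..t}"
proof -
  define g where "g s = s * (\<sigma> + t) / (t * (\<sigma> + s))" for s
  define g' where "g' s = \<sigma> * (\<sigma> + t) / (t * (\<sigma> + s)^2)" for s
  define C where "C = t powr (a + b - 1) * \<sigma> powr (- b) * (\<sigma> + t) powr (- a)"
  have der: "(g has_field_derivative g' s) (at s within {0<..<t})" if "s \<in> {0<..<t}" for s
  proof -
    have "((\<lambda>s. (\<sigma> + t) / t * (s / (\<sigma> + s))) has_field_derivative (\<sigma> + t) / t * (\<sigma> / (\<sigma> + s)^2))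
        (at s within {0<..<t})"
      using that assms
      by (intro DERIV_cmult) (auto intro!: derivative_eq_intros simp: field_simps power2_eq_square)
    moreover have "g = (\<lambda>s. (\<sigma> + t) / t * (s / (\<sigma> + s)))" by (auto simp: g_def)
    moreover have "g' s = (\<sigma> + t) / t * (\<sigma> / (\<sigma> + s)^2)" by (simp add: g'_def)
    ultimately show ?thesis by simp
  qed
  have g1: "1 - g s = \<sigma> * (t - s) / (t * (\<sigma> + s))" if "s \<in> {0<..<t}" for s
  proof -
    have "t * (\<sigma> + s) \<noteq> 0" using that assms by auto
    then have "1 - g s = (t * (\<sigma> + s) - s * (\<sigma> + t)) / (t * (\<sigma> + s))"
      unfolding g_def diff_divide_distrib by (metis divide_self)
    also have "t * (\<sigma> + s) - s * (\<sigma> + t) = \<sigma> * (t - s)" by (simp add: algebra_simps)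
    finally show ?thesis .
  qed
  have im1: "g s \<in> {0<..<1}" if "s \<in> {0<..<t}" for s
  proof -
    have "0 < 1 - g s" unfolding g1[OF that] using that assms by simp
    moreover have "0 < g s" unfolding g_def using that assms by simp
    ultimately show ?thesis by simp
  qed
  \<comment> \<open>The preimage of \<open>z\<close> solves \<open>g s = z\<close>, which is linear
    in \<open>s\<close> once the denominator is cleared.\<close>
  have inv: "g (\<sigma> * t * z / (\<sigma> + t - t * z)) = z \<and> \<sigma> * t * z / (\<sigma> + t - t * z) \<in> {0<..<t}"
    if "z \<in> {0<..<1}" for z
  proof -
    have "t * z < t * 1" using that assms by (intro mult_strict_left_mono) auto
    then have p: "\<sigma> + t - t * z > 0" using \<open>\<sigma> > 0\<close> by linarith
    have "\<sigma> * t * z < t * (\<sigma> + t - t * z)"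
    proof -
      have "t * (\<sigma> + t - t * z) - \<sigma> * t * z = t * (\<sigma> + t) * (1 - z)" by (simp add: algebra_simps)
      moreover have "t * (\<sigma> + t) * (1 - z) > 0" using that assms by auto
      ultimately show ?thesis by linarith
    qed
    moreover have q: "\<sigma> + \<sigma> * t * z / (\<sigma> + t - t * z) = \<sigma> * (\<sigma> + t) / (\<sigma> + t - t * z)"
      using p by (simp add: field_simps)
    have "\<sigma> * t * z / D * S / (t * (\<sigma> * S / D)) = z" if "D > 0" "S > 0" for D S
      using that assms by simp
    from this[OF p, of "\<sigma> + t"] have "g (\<sigma> * t * z / (\<sigma> + t - t * z)) = z"
      unfolding g_def q using assms by simp
    ultimately show ?thesis using p that assms by (auto simp: divide_simps)
  qed
  have im: "g ` {0<..<t} = {0<..<1}" using im1 inv by (auto simp: image_iff) (metis greaterThanLessThan_iff)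
  have inj: "inj_on g {0<..<t}"
  proof (rule inj_onI)
    fix x y assume "x \<in> {0<..<t}" "y \<in> {0<..<t}" "g x = g y"
    then have "x * (\<sigma> + t) * (t * (\<sigma> + y)) = y * (\<sigma> + t) * (t * (\<sigma> + x))"
      using assms by (auto simp: g_def frac_eq_eq)
    then have "(\<sigma> + t) * t * \<sigma> * (x - y) = 0" by (simp add: algebra_simps)
    then show "x = y" using assms by auto
  qed
  have eq: "s powr (a - 1) * (\<sigma> + s) powr (- a - b) * (t - s) powr (b - 1) / C
      = g' s * (g s powr (a - 1) * (1 - g s) powr (b - 1))" if "s \<in> {0<..<t}" for s
  proof -
    have s: "0 < s" "0 < t - s" "0 < \<sigma> + s" "0 < \<sigma> + t" "0 < t" using that assms by auto
    have "s powr (a - 1) * q powr (- a - b) * d powr (b - 1) / (t powr (a + b - 1) * \<sigma> powr (- b) * S powr (- a))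
        = \<sigma> * S / (t * q^2) * ((s * S / (t * q)) powr (a - 1) * (\<sigma> * d / (t * q)) powr (b - 1))"
      if "q > 0" "S > 0" "d > 0" for q S d
      using that s assms
      by (simp add: powr_mult powr_divide powr_diff powr_minus powr_add field_simps power2_eq_square)
    from this[OF s(3,4,2)] show ?thesis unfolding g1[OF that] C_def g'_def unfolding g_def .
  qed
  have "((\<lambda>s. s powr (a - 1) * (\<sigma> + s) powr (- a - b) * (t - s) powr (b - 1) / C) has_integral
    integral {0..1} (\<lambda>z. z powr (a - 1) * (1 - z) powr (b - 1))) {0..t}"
    by (rule beta_substitution[where g = g and g' = g', OF assms(1,2) _ _ der _ inj im eq])
      (use assms in \<open>auto simp: g'_def\<close>)
  then have "((\<lambda>s. C * (s powr (a - 1) * (\<sigma> + s) powr (- a - b) * (t - s) powr (b - 1) / C)) has_integral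
    C * Beta a b) {0..t}"
    using has_integral_Beta_real[OF assms(1,2)] by (intro has_integral_mult_right) (simp add: has_integral_iff)
  moreover have "C \<noteq> 0" using assms by (auto simp: C_def)
  ultimately show ?thesis by (simp add: C_def mult_ac)
qed

text \<open>Here \<open>g s = s / (\<sigma> + s)\<close> and
  \<open>1 - g s = \<sigma> / (\<sigma> + s)\<close>. The upper limit stays below \<open>1\<close>,
  so an incomplete Beta integral appears; its limit for large \<open>t\<close> gives the mass of the
  kernel.\<close>

lemma has_integral_beta_prime:
  fixes a b \<sigma> t :: real
  assumes "a > 0" "b > 0" "\<sigma> > 0" "t > 0"
  shows "((\<lambda>s. \<sigma> powr b * (s powr (a - 1) * (\<sigma> + s) powr (- a - b))) has_integral
    integral {0..t / (\<sigma> + t)} (\<lambda>z. z powr (a - 1) * (1 - z) powr (b - 1))) {0..t}"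
proof -
  define g where "g s = s / (\<sigma> + s)" for s
  define g' where "g' s = \<sigma> / (\<sigma> + s)^2" for s
  have der: "(g has_field_derivative g' s) (at s within {0<..<t})" if "s \<in> {0<..<t}" for s
    unfolding g_def g'_def using that assms
    by (auto intro!: derivative_eq_intros simp: field_simps power2_eq_square)
  have im1: "g s \<in> {0<..<t / (\<sigma> + t)}" if "s \<in> {0<..<t}" for s
    using that assms by (auto simp: g_def field_simps)
  have inv: "g (\<sigma> * z / (1 - z)) = z \<and> \<sigma> * z / (1 - z) \<in> {0<..<t}" if "z \<in> {0<..<t / (\<sigma> + t)}" for z
  proof -
    have *: "z * (\<sigma> + t) < t" using that assms by (auto simp: field_simps)
    have "t / (\<sigma> + t) < 1" using assms by simp
    then have p: "1 - z > 0" using that by auto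
    have q: "\<sigma> + \<sigma> * z / (1 - z) = \<sigma> / (1 - z)" using p by (simp add: field_simps)
    have "g (\<sigma> * z / (1 - z)) = z"
      unfolding g_def q using p assms by (simp add: field_simps)
    then show ?thesis using p that assms * by (auto simp: field_simps)
  qed
  have im: "g ` {0<..<t} = {0<..<t / (\<sigma> + t)}"
    using im1 inv by (auto simp: image_iff) (metis greaterThanLessThan_iff)
  have inj: "inj_on g {0<..<t}"
  proof (rule inj_onI)
    fix x y assume "x \<in> {0<..<t}" "y \<in> {0<..<t}" "g x = g y"
    then have "x * (\<sigma> + y) = y * (\<sigma> + x)"
      using assms by (auto simp: g_def frac_eq_eq)
    then have "\<sigma> * (x - y) = 0" by (simp add: algebra_simps)
    then show "x = y" using assms by auto
  qed
  have eq: "\<sigma> powr b * (s powr (a - 1) * (\<sigma> + s) powr (- a - b))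
      = g' s * (g s powr (a - 1) * (1 - g s) powr (b - 1))" if "s \<in> {0<..<t}" for s
  proof -
    have s: "0 < s" "0 < \<sigma> + s" using that assms by auto
    have 1: "1 - g s = \<sigma> / (\<sigma> + s)" using s by (simp add: g_def field_simps)
    have "\<sigma> powr b * (s powr (a - 1) * q powr (- a - b))
        = \<sigma> / q^2 * ((s / q) powr (a - 1) * (\<sigma> / q) powr (b - 1))" if "q > 0" for q
      using s assms that
      by (simp add: powr_divide powr_diff powr_minus powr_add field_simps power2_eq_square)
    from this[OF s(2)] show ?thesis unfolding 1 g'_def unfolding g_def .
  qed
  show ?thesis
    by (rule beta_substitution[where g = g and g' = g', OF assms(1,2) _ _ der _ inj im eq])
      (use assms in \<open>auto simp: g'_def\<close>)
qed

section \<open>Convolution kernels\<close>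

definition frac_kernel :: "real \<Rightarrow> real \<Rightarrow> real" where
  "frac_kernel \<alpha> t = t powr (\<alpha> - 1) / Gamma \<alpha>"

text \<open>Strict concavity: between \<open>x\<close> and \<open>1\<close> the derivative of the
  power exceeds its value \<open>\<alpha>\<close> at \<open>1\<close>.\<close>

lemma powr_less_tangent_one:
  fixes \<alpha> x :: real
  assumes "0 < \<alpha>" "\<alpha> < 1" "0 < x" "x < 1"
  shows "x powr \<alpha> < 1 - \<alpha> * (1 - x)"
proof -
  obtain z where z: "x < z" "z < 1" "1 powr \<alpha> - x powr \<alpha> = (1 - x) * (\<alpha> * z powr (\<alpha> - 1))"
    using MVT2[of x 1 "\<lambda>x. x powr \<alpha>" "\<lambda>x. \<alpha> * x powr (\<alpha> - 1)"] assms
    by (metis (no_types, lifting) has_real_derivative_powr less_le_trans)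
  have "1 < z powr (\<alpha> - 1)"
    using z assms powr_less_mono2_neg[of "\<alpha> - 1" z 1] by simp
  then have "(1 - x) * (\<alpha> * 1) < (1 - x) * (\<alpha> * z powr (\<alpha> - 1))"
    using assms by (intro mult_strict_left_mono) auto
  with z(3) show ?thesis by (simp add: mult.commute)
qed

lemma Gamma_one_plus:
  fixes x :: real
  assumes "x > 0"
  shows "Gamma (1 + x) = x * Gamma x"
proof -
  have "x \<notin> \<int>\<^sub>\<le>\<^sub>0" using assms by (auto elim!: nonpos_Ints_cases)
  from Gamma_plus1[OF this] show ?thesis by (simp add: add.commute)
qed

text \<open>Equivalent to \<open>Gamma (1 + \<alpha>)^2 < Gamma (2 * \<alpha>) * Gamma 2\<close>,
  which is strict convexity of \<open>ln_Gamma\<close> at \<open>1 + \<alpha>\<close>, the midpoint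
  of \<open>2 * \<alpha>\<close> and \<open>2\<close>. Convexity enters through the mean value
  theorem on both halves and the monotonicity of \<open>Digamma\<close>.\<close>

lemma Beta_diagonal_less:
  fixes \<alpha> :: real
  assumes "0 < \<alpha>" "\<alpha> < 1"
  shows "\<alpha>^2 * Beta \<alpha> \<alpha> < 1"
proof -
  have D: "\<exists>z. x < z \<and> z < y \<and> ln_Gamma y - ln_Gamma x = (y - x) * Digamma z"
    if "0 < x" "x < y" for x y :: real
    using that by (intro MVT2) (auto intro!: has_field_derivative_ln_Gamma_real)
  obtain z1 where z1: "2 * \<alpha> < z1" "z1 < 1 + \<alpha>"
      "ln_Gamma (1 + \<alpha>) - ln_Gamma (2 * \<alpha>) = (1 + \<alpha> - 2 * \<alpha>) * Digamma z1"
    using D[of "2 * \<alpha>" "1 + \<alpha>"] assms by auto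
  obtain z2 where z2: "1 + \<alpha> < z2" "z2 < 2"
      "ln_Gamma 2 - ln_Gamma (1 + \<alpha>) = (2 - (1 + \<alpha>)) * Digamma z2"
    using D[of "1 + \<alpha>" 2] assms by auto
  have "Digamma z1 < Digamma z2" using z1 z2 assms by (intro Digamma_real_strict_mono) auto
  then have "(1 - \<alpha>) * Digamma z1 < (1 - \<alpha>) * Digamma z2" using assms by simp
  moreover have G2: "Gamma 2 = (1::real)" using Gamma_fact[of 1, where 'a = real] by simp
  have "ln_Gamma 2 = (0::real)" using Gamma_real_pos_exp[of 2] G2 by simp
  ultimately have "ln_Gamma (1 + \<alpha>) + ln_Gamma (1 + \<alpha>) < ln_Gamma (2 * \<alpha>)"
    using z1(3) z2(3) by (simp add: algebra_simps)
  then have "exp (ln_Gamma (1 + \<alpha>)) * exp (ln_Gamma (1 + \<alpha>)) < exp (ln_Gamma (2 * \<alpha>))"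
    by (simp flip: exp_add)
  then have "Gamma (1 + \<alpha>) * Gamma (1 + \<alpha>) < Gamma (\<alpha> + \<alpha>)"
    using assms by (simp add: Gamma_real_pos_exp)
  moreover have "Gamma (1 + \<alpha>) = \<alpha> * Gamma \<alpha>"
    using assms by (simp add: Gamma_one_plus)
  ultimately show ?thesis
    using assms Gamma_real_pos[of "\<alpha> + \<alpha>"] by (simp add: Beta_def power2_eq_square mult_ac)
qed

section \<open>Convolution with a locally integrable kernel\<close>

definition conv :: "(real \<Rightarrow> real) \<Rightarrow> (real \<Rightarrow> 'a::euclidean_space) \<Rightarrow> real \<Rightarrow> 'a" where
  "conv \<kappa> g t = integral {0..t} (\<lambda>v. \<kappa> v *\<^sub>R g (t - v))"

text \<open>Borel measurability serves Fubini's theorem on the product measure in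
  \<open>conv_assoc\<close>; the sign condition turns integrability into absolute
  integrability.\<close>

definition volterra_kernel :: "(real \<Rightarrow> real) \<Rightarrow> bool" where
  "volterra_kernel \<kappa> \<longleftrightarrow> \<kappa> \<in> borel_measurable borel \<and> (\<forall>v\<ge>0. 0 \<le> \<kappa> v) \<and> (\<forall>t. \<kappa> integrable_on {0..t})"

lemma volterra_kernelD:
  assumes "volterra_kernel \<kappa>"
  shows "\<kappa> \<in> borel_measurable borel" "v \<ge> 0 \<Longrightarrow> 0 \<le> \<kappa> v" "\<kappa> integrable_on {0..t}"
    "\<kappa> absolutely_integrable_on {0..t}"
  using assms by (auto simp: volterra_kernel_def intro!: nonnegative_absolutely_integrable_1)

lemma volterra_kernel_frac_kernel:
  assumes "0 < \<alpha>"
  shows "volterra_kernel (frac_kernel \<alpha>)"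
  unfolding volterra_kernel_def
proof (intro conjI allI impI)
  show "frac_kernel \<alpha> \<in> borel_measurable borel" unfolding frac_kernel_def[abs_def] by measurable
  show "0 \<le> frac_kernel \<alpha> v" for v
    using Gamma_real_pos[OF assms] by (simp add: frac_kernel_def)
  show "frac_kernel \<alpha> integrable_on {0..t}" for t
  proof (cases "t \<ge> 0")
    case True
    then show ?thesis unfolding frac_kernel_def[abs_def]
      using assms by (intro integrable_on_divide integrable_on_powr_from_0) auto
  qed (simp add: integrable_on_empty)
qed

lemma volterra_kernel_bound:
  assumes "volterra_kernel \<kappa>" "\<rho> \<in> borel_measurable borel" "\<And>v. v \<ge> 0 \<Longrightarrow> 0 \<le> \<rho> v \<and> \<rho> v \<le> C * \<kappa> v"
  shows "volterra_kernel \<rho>"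
  unfolding volterra_kernel_def
proof (intro conjI allI impI)
  fix t :: real
  have "(\<lambda>v. C * \<kappa> v) integrable_on {0..t}"
    using volterra_kernelD(3)[OF assms(1)] by (intro integrable_on_mult_right) auto
  then have "\<rho> absolutely_integrable_on {0..t}"
    using assms(2,3) by (intro measurable_bounded_by_integrable_imp_absolutely_integrable[where g = "\<lambda>v. C * \<kappa> v"])
      (auto intro: borel_measurable_subalgebra simp: measurable_completion measurable_restrict_space1)
  then show "\<rho> integrable_on {0..t}" by (rule set_lebesgue_integral_eq_integral(1))
qed (use assms in auto)

lemma conv_absolutely_integrable:
  fixes g :: "real \<Rightarrow> 'a::euclidean_space"
  assumes \<kappa>: "volterra_kernel \<kappa>" and g: "continuous_on UNIV g"
  shows "(\<lambda>v. \<kappa> v *\<^sub>R g (s - v)) absolutely_integrable_on {0..t}"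
proof -
  have c: "continuous_on {0..t} (\<lambda>v. g (s - v))"
    by (intro continuous_intros continuous_on_compose2[OF g]) auto
  have "(\<lambda>v. (\<lambda>x r. r *\<^sub>R x) (g (s - v)) (\<kappa> v)) absolutely_integrable_on {0..t}"
  proof (rule absolutely_integrable_bounded_measurable_product[where h = "\<lambda>x r. r *\<^sub>R x"])
    show "bilinear (\<lambda>(x::'a) r. r *\<^sub>R x)"
      by (auto simp: bilinear_def linear_iff scaleR_add_left scaleR_add_right)
    show "(\<lambda>v. g (s - v)) \<in> borel_measurable (lebesgue_on {0..t})"
      using c by (intro continuous_imp_measurable_on_sets_lebesgue) auto
    show "bounded ((\<lambda>v. g (s - v)) ` {0..t})"
      using c by (intro compact_imp_bounded compact_continuous_image) auto
  qed (use volterra_kernelD(4)[OF \<kappa>] in auto)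
  then show ?thesis by simp
qed

lemma conv_integrable:
  fixes g :: "real \<Rightarrow> 'a::euclidean_space"
  assumes "volterra_kernel \<kappa>" "continuous_on UNIV g"
  shows "(\<lambda>v. \<kappa> v *\<^sub>R g (s - v)) integrable_on {0..t}"
  using conv_absolutely_integrable[OF assms] by (rule set_lebesgue_integral_eq_integral(1))

lemma conv_cong: "(\<And>s. 0 \<le> s \<Longrightarrow> s \<le> t \<Longrightarrow> g s = h s) \<Longrightarrow> conv \<kappa> g t = conv \<kappa> h t"
  unfolding conv_def by (rule integral_cong) auto

lemma conv_const: "conv \<kappa> (\<lambda>_. c) t = integral {0..t} \<kappa> *\<^sub>R c" if "volterra_kernel \<kappa>"
  unfolding conv_def
  using has_integral_scaleR_left[OF integrable_integral[OF volterra_kernelD(3)[OF that]]] by (rule integral_unique)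

lemma conv_add:
  assumes "volterra_kernel \<kappa>" "continuous_on UNIV g" "continuous_on UNIV h"
  shows "conv \<kappa> (\<lambda>s. g s + h s) t = conv \<kappa> g t + conv \<kappa> h t"
  unfolding conv_def scaleR_add_right
  by (intro integral_add conv_integrable assms)

lemma conv_diff:
  assumes "volterra_kernel \<kappa>" "continuous_on UNIV g" "continuous_on UNIV h"
  shows "conv \<kappa> (\<lambda>s. g s - h s) t = conv \<kappa> g t - conv \<kappa> h t"
  unfolding conv_def scaleR_diff_right
  by (intro integral_diff conv_integrable assms)

text \<open>With \<open>g\<close> continued by \<open>g 0\<close> to negative times and
  \<open>g 0\<close> subtracted, the integrand vanishes for \<open>v > t\<close>. The integral then
  runs over a fixed interval with a fixed kernel, only the continuous factor moves with
  \<open>t\<close>, and dominated convergence applies.\<close>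

lemma continuous_on_conv:
  fixes g :: "real \<Rightarrow> 'a::euclidean_space"
  assumes \<kappa>: "volterra_kernel \<kappa>" and g: "continuous_on UNIV g"
  shows "continuous_on {0..} (conv \<kappa> g)"
proof -
  define G where "G s = g (max 0 s) - g 0" for s
  have G: "continuous_on UNIV G" unfolding G_def
    by (intro continuous_intros continuous_on_compose2[OF g]) auto
  have eq: "conv \<kappa> g t = integral {0..t} \<kappa> *\<^sub>R g 0 + integral {0..T} (\<lambda>v. \<kappa> v *\<^sub>R G (t - v))"
    if "0 \<le> t" "t \<le> T" for t T
  proof -
    have "conv \<kappa> g t = conv \<kappa> (\<lambda>s. g 0 + G s) t" by (rule conv_cong) (auto simp: G_def)
    also have "\<dots> = conv \<kappa> (\<lambda>s. g 0) t + conv \<kappa> G t" by (rule conv_add[OF \<kappa> _ G]) auto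
    also have "conv \<kappa> G t = integral {0..T} (\<lambda>v. \<kappa> v *\<^sub>R G (t - v))"
    proof -
      have "integral {t..T} (\<lambda>v. \<kappa> v *\<^sub>R G (t - v)) = integral {t..T} (\<lambda>v. 0)"
        by (rule integral_cong) (auto simp: G_def)
      then show ?thesis
        using Henstock_Kurzweil_Integration.integral_combine[OF that conv_integrable[OF \<kappa> G], of t] by (simp add: conv_def)
    qed
    finally show ?thesis by (simp add: conv_const[OF \<kappa>])
  qed
  have cont: "continuous_on {0..T} (conv \<kappa> g)" if T: "T \<ge> 0" for T
  proof -
    have "continuous_on {0..T} (\<lambda>t. integral {0..T} (\<lambda>v. \<kappa> v *\<^sub>R G (t - v)))"
      unfolding continuous_on_sequentially
    proof (intro allI impI ballI, elim conjE)
      fix X t assume t: "t \<in> {0..T}" and X: "\<forall>n. X n \<in> {0..T}" "X \<longlonglongrightarrow> t"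
      obtain M where M: "\<And>s. s \<in> {-T..T} \<Longrightarrow> norm (G s) \<le> M"
        using compact_imp_bounded[OF compact_continuous_image[OF continuous_on_subset[OF G subset_UNIV], of "{-T..T}"]]
        unfolding bounded_iff by (metis compact_Icc imageI)
      show "((\<lambda>t. integral {0..T} (\<lambda>v. \<kappa> v *\<^sub>R G (t - v))) \<circ> X) \<longlonglongrightarrow> integral {0..T} (\<lambda>v. \<kappa> v *\<^sub>R G (t - v))"
        unfolding o_def
      proof (rule dominated_convergence(2)[where h = "\<lambda>v. \<kappa> v * M"])
        show "(\<lambda>v. \<kappa> v *\<^sub>R G (X n - v)) integrable_on {0..T}" for n by (rule conv_integrable[OF \<kappa> G])
        show "(\<lambda>v. \<kappa> v * M) integrable_on {0..T}"
          using volterra_kernelD(3)[OF \<kappa>] by (intro integrable_on_mult_left) auto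
        show "norm (\<kappa> v *\<^sub>R G (X n - v)) \<le> \<kappa> v * M" if "v \<in> {0..T}" for n v
        proof -
          have "X n \<in> {0..T}" using X(1) by blast
          then have "norm (G (X n - v)) \<le> M" using that by (intro M) auto
          then show ?thesis using volterra_kernelD(2)[OF \<kappa>, of v] that by (auto intro: mult_left_mono)
        qed
        show "(\<lambda>n. \<kappa> v *\<^sub>R G (X n - v)) \<longlonglongrightarrow> \<kappa> v *\<^sub>R G (t - v)" for v
          by (intro tendsto_intros continuous_on_tendsto_compose[OF G] X) auto
      qed
    qed
    moreover have "continuous_on {0..T} (\<lambda>t. integral {0..t} \<kappa>)"
      by (rule indefinite_integral_continuous_1[OF volterra_kernelD(3)[OF \<kappa>]])
    ultimately have "continuous_on {0..T} (\<lambda>t. integral {0..t} \<kappa> *\<^sub>R g 0 + integral {0..T} (\<lambda>v. \<kappa> v *\<^sub>R G (t - v)))"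
      by (intro continuous_intros)
    then show ?thesis by (rule continuous_on_eq) (use eq in auto)
  qed
  show ?thesis unfolding continuous_on_eq_continuous_within
  proof
    fix t :: real assume "t \<in> {0..}"
    then have "continuous (at t within {0..t+1}) (conv \<kappa> g)"
      using cont[of "t + 1"] by (auto simp: continuous_on_eq_continuous_within)
    moreover have "at t within {0..t+1} = at t within {0..}"
      by (rule at_within_nhd[of t "{..<t+1}"]) auto
    ultimately show "continuous (at t within {0..}) (conv \<kappa> g)" by simp
  qed
qed

lemma set_integrable_lborelI:
  fixes f :: "real \<Rightarrow> 'a::euclidean_space"
  assumes "f absolutely_integrable_on S" "f \<in> borel_measurable borel" "S \<in> sets borel"
  shows "set_integrable lborel S f"
  using assms unfolding set_integrable_def by (subst (asm) integrable_completion) auto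

text \<open>Fubini's theorem on the triangle \<open>0 \<le> v \<le> s \<le> t\<close>: integrating
  first over \<open>v\<close> produces \<open>\<rho> s\<close>, integrating first over
  \<open>s\<close> produces \<open>\<kappa> v *\<^sub>R conv k g (t - v)\<close>.\<close>

lemma conv_assoc:
  fixes g :: "real \<Rightarrow> 'a::euclidean_space"
  assumes \<kappa>: "volterra_kernel \<kappa>" and k: "volterra_kernel k" and \<rho>: "volterra_kernel \<rho>"
    and conv: "\<And>t. t \<ge> 0 \<Longrightarrow> ((\<lambda>s. \<kappa> s * k (t - s)) has_integral \<rho> t) {0..t}"
    and g: "continuous_on UNIV g" and t: "t \<ge> 0"
  shows "conv \<kappa> (conv k g) t = conv \<rho> g t"
proof -
  note [measurable] = volterra_kernelD(1)[OF \<kappa>] volterra_kernelD(1)[OF k] volterra_kernelD(1)[OF \<rho>]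
    borel_measurable_continuous_onI[OF g]
  define F where "F s v = indicator {0..t} s *\<^sub>R (indicator {0..s} v *\<^sub>R ((\<kappa> v * k (s - v)) *\<^sub>R g (t - s)))" for s v
  have Fm: "case_prod F \<in> borel_measurable (lborel \<Otimes>\<^sub>M lborel)"
  proof -
    have "(\<lambda>(s, v). (if 0 \<le> s \<and> s \<le> t \<and> 0 \<le> v \<and> v \<le> s then 1 else 0) *\<^sub>R ((\<kappa> v * k (s - v)) *\<^sub>R g (t - s)))
        \<in> borel_measurable (borel \<Otimes>\<^sub>M borel)"
      by measurable
    also have "(\<lambda>(s, v). (if 0 \<le> s \<and> s \<le> t \<and> 0 \<le> v \<and> v \<le> s then 1 else 0) *\<^sub>R ((\<kappa> v * k (s - v)) *\<^sub>R g (t - s)))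
        = case_prod F" by (auto simp: F_def fun_eq_iff indicator_def)
    finally show ?thesis by (simp add: lborel_prod borel_prod)
  qed
  have inner: "integrable lborel (\<lambda>v. indicator {0..s} v *\<^sub>R (\<kappa> v * k (s - v)))"
      "(\<integral>v. indicator {0..s} v *\<^sub>R (\<kappa> v * k (s - v)) \<partial>lborel) = \<rho> s" if "s \<ge> 0" for s
  proof -
    have "(\<lambda>v. \<kappa> v * k (s - v)) absolutely_integrable_on {0..s}"
      using conv[OF that] volterra_kernelD(2)[OF \<kappa>] volterra_kernelD(2)[OF k]
      by (intro nonnegative_absolutely_integrable_1) auto
    then have *: "set_integrable lborel {0..s} (\<lambda>v. \<kappa> v * k (s - v))"
      by (rule set_integrable_lborelI) auto
    then show "integrable lborel (\<lambda>v. indicator {0..s} v *\<^sub>R (\<kappa> v * k (s - v)))"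
      by (simp add: set_integrable_def)
    show "(\<integral>v. indicator {0..s} v *\<^sub>R (\<kappa> v * k (s - v)) \<partial>lborel) = \<rho> s"
      using set_borel_integral_eq_integral(2)[OF *] integral_unique[OF conv[OF that]]
      by (simp add: set_lebesgue_integral_def)
  qed
  have Fs: "(\<integral>v. F s v \<partial>lborel) = indicator {0..t} s *\<^sub>R (\<rho> s *\<^sub>R g (t - s))" for s
  proof (cases "s \<in> {0..t}")
    case True
    then have "(\<integral>v. F s v \<partial>lborel) = (\<integral>v. (indicator {0..s} v *\<^sub>R (\<kappa> v * k (s - v))) *\<^sub>R g (t - s) \<partial>lborel)"
      by (simp add: F_def)
    also have "\<dots> = \<rho> s *\<^sub>R g (t - s)"
      using inner[of s] True by (subst integral_scaleR_left) auto
    finally show ?thesis using True by simp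
  qed (simp add: F_def)
  have conv\<rho>: "(\<integral>s. indicator {0..t} s *\<^sub>R (\<rho> s *\<^sub>R g (t - s)) \<partial>lborel) = conv \<rho> g t"
      "integrable lborel (\<lambda>s. indicator {0..t} s *\<^sub>R (\<rho> s *\<^sub>R g (t - s)))"
    using set_borel_integral_eq_integral(2)[OF set_integrable_lborelI[OF conv_absolutely_integrable[OF \<rho> g, of t t]]]
      set_integrable_lborelI[OF conv_absolutely_integrable[OF \<rho> g, of t t]]
    by (auto simp: conv_def set_lebesgue_integral_def set_integrable_def)
  have Fint: "integrable (lborel \<Otimes>\<^sub>M lborel) (case_prod F)"
  proof (rule lborel_pair.Fubini_integrable[OF Fm])
    \<comment> \<open>Both kernels are nonnegative, so the norm only affects \<open>g\<close> and
      the inner integral is again given by \<open>inner\<close>.\<close>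
    have "(\<integral>v. norm (F s v) \<partial>lborel) = norm (indicator {0..t} s *\<^sub>R (\<rho> s *\<^sub>R g (t - s)))" for s
    proof (cases "s \<in> {0..t}")
      case True
      have "norm (F s v) = (indicator {0..s} v *\<^sub>R (\<kappa> v * k (s - v))) *\<^sub>R norm (g (t - s))" for v
        using True volterra_kernelD(2)[OF \<kappa>] volterra_kernelD(2)[OF k] by (auto simp: F_def indicator_def abs_mult)
      then have "(\<integral>v. norm (F s v) \<partial>lborel)
          = (\<integral>v. (indicator {0..s} v *\<^sub>R (\<kappa> v * k (s - v))) *\<^sub>R norm (g (t - s)) \<partial>lborel)"
        by presburger
      also have "\<dots> = \<rho> s *\<^sub>R norm (g (t - s))"
        using inner[of s] True by (subst integral_scaleR_left) auto
      finally have "(\<integral>v. norm (F s v) \<partial>lborel) = \<rho> s *\<^sub>R norm (g (t - s))" .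
      then show ?thesis using True volterra_kernelD(2)[OF \<rho>, of s] by simp
    qed (simp add: F_def)
    then show "integrable lborel (\<lambda>s. \<integral>v. norm (case_prod F (s, v)) \<partial>lborel)"
      using integrable_norm[OF conv\<rho>(2)] by simp
    show "AE s in lborel. integrable lborel (\<lambda>v. case_prod F (s, v))"
    proof (rule AE_I2)
      fix s show "integrable lborel (\<lambda>v. case_prod F (s, v))"
      proof (cases "s \<in> {0..t}")
        case True
        then have "(\<lambda>v. case_prod F (s, v)) = (\<lambda>v. (indicator {0..s} v *\<^sub>R (\<kappa> v * k (s - v))) *\<^sub>R g (t - s))"
          by (simp add: F_def fun_eq_iff)
        then show ?thesis using inner(1)[of s] True by (auto intro: integrable_scaleR_left)
      qed (simp add: F_def)
    qed
  qed
  have Fv: "(\<integral>s. F s v \<partial>lborel) = indicator {0..t} v *\<^sub>R (\<kappa> v *\<^sub>R conv k g (t - v))" for v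
  proof -
    have "(\<integral>s. F s v \<partial>lborel) = (\<integral>u. F (v + u) v \<partial>lborel)"
      using lborel_integral_real_affine[of 1 "\<lambda>s. F s v" v] by simp
    also have "\<dots> = (\<integral>u. (indicator {0..t} v * \<kappa> v) *\<^sub>R (indicator {0..t - v} u *\<^sub>R (k u *\<^sub>R g (t - v - u))) \<partial>lborel)"
      by (intro Bochner_Integration.integral_cong) (auto simp: F_def indicator_def algebra_simps)
    also have "\<dots> = (indicator {0..t} v * \<kappa> v) *\<^sub>R
        (\<integral>u. indicator {0..t - v} u *\<^sub>R (k u *\<^sub>R g (t - v - u)) \<partial>lborel)"
      by (rule integral_scaleR_right)
    also have "\<dots> = (indicator {0..t} v * \<kappa> v) *\<^sub>R conv k g (t - v)"
      using set_borel_integral_eq_integral(2)[OF set_integrable_lborelI[OF conv_absolutely_integrable[OF k g, of "t - v" "t - v"]]]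
      by (simp add: conv_def set_lebesgue_integral_def)
    finally show ?thesis by simp
  qed
  \<comment> \<open>\<open>conv k g\<close> is known to be continuous only on nonnegative times;
    composing with \<open>max 0\<close> extends it continuously without changing the
    convolution.\<close>
  have c1: "continuous_on UNIV (\<lambda>s. conv k g (max 0 s))"
    by (intro continuous_on_compose2[OF continuous_on_conv[OF k g]] continuous_intros) auto
  have "conv \<kappa> (conv k g) t = conv \<kappa> (\<lambda>s. conv k g (max 0 s)) t"
    by (rule conv_cong) auto
  also have "\<dots> = (\<integral>v. indicator {0..t} v *\<^sub>R (\<kappa> v *\<^sub>R conv k g (max 0 (t - v))) \<partial>lborel)"
    using set_borel_integral_eq_integral(2)[OF set_integrable_lborelI[OF conv_absolutely_integrable[OF \<kappa> c1, of t t]]]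
      borel_measurable_continuous_onI[OF c1]
    by (simp add: conv_def set_lebesgue_integral_def)
  also have "\<dots> = (\<integral>v. (\<integral>s. F s v \<partial>lborel) \<partial>lborel)"
    unfolding Fv by (intro Bochner_Integration.integral_cong) (auto simp: indicator_def)
  also have "\<dots> = (\<integral>s. (\<integral>v. F s v \<partial>lborel) \<partial>lborel)"
    by (rule lborel_pair.Fubini_integral[OF Fint])
  also have "\<dots> = conv \<rho> g t" unfolding Fs conv\<rho>(1) ..
  finally show ?thesis .
qed

lemma RL_integral_eq_conv:
  assumes "t \<ge> 0" "0 < \<alpha>"
  shows "RL_integral \<alpha> g t = conv (frac_kernel \<alpha>) g t"
proof -
  let ?f = "\<lambda>v. frac_kernel \<alpha> v *\<^sub>R g (t - v)"
  have "integral {0..t} (\<lambda>s. ?f (t - s)) = integral {-t..0} (\<lambda>x. ?f (t + x))"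
    using Henstock_Kurzweil_Integration.integral_reflect_real[of 0 "-t" "\<lambda>x. ?f (t + x)"] by simp
  also have "\<dots> = integral {0..t} ?f"
    using integral_shift_Icc_real[of "-t" 0 ?f t] by (simp add: o_def)
  finally have "integral {0..t} (\<lambda>s. ?f (t - s)) = integral {0..t} ?f" .
  moreover have "(\<lambda>s. ?f (t - s)) = (\<lambda>s. (1 / Gamma \<alpha>) *\<^sub>R ((t - s) powr (\<alpha> - 1) *\<^sub>R g s))"
    by (auto simp: frac_kernel_def)
  ultimately show ?thesis
    by (simp only: RL_integral_def conv_def integral_cmul)
qed

lemma conv_kernel_diff:
  fixes g :: "real \<Rightarrow> 'a::euclidean_space"
  assumes "volterra_kernel \<kappa>" "volterra_kernel \<rho>" "continuous_on UNIV g"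
  shows "conv (\<lambda>v. \<kappa> v - \<rho> v) g t = conv \<kappa> g t - conv \<rho> g t"
  unfolding conv_def scaleR_diff_left
  by (intro integral_diff conv_integrable assms)

lemma conv_zero [simp]: "conv \<kappa> g 0 = 0"
  by (simp add: conv_def)

section \<open>The averaged Volterra equation\<close>

text \<open>The convolution identity makes \<open>p\<close> the part of the fractional kernel that
  is lost by averaging with \<open>\<mu>\<close>. Because of \<open>p_le\<close>, the quotient
  \<open>p s / \<mu> s\<close> can serve as the length of an Euler step not exceeding
  \<open>\<tau>\<close>.\<close>

locale averaging_kernel =
  fixes \<alpha> \<tau> :: real and \<mu> p :: "real \<Rightarrow> real"
  assumes \<alpha>: "0 < \<alpha>" "\<alpha> < 1" and \<tau>: "0 < \<tau>"
    and \<mu>: "volterra_kernel \<mu>" and p: "volterra_kernel p"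
    and p_pos: "s > 0 \<Longrightarrow> 0 < p s" and p_0: "p 0 = 0"
    and p_le: "s \<ge> 0 \<Longrightarrow> p s \<le> \<tau> * \<mu> s"
    and \<mu>_conv: "t > 0 \<Longrightarrow>
      ((\<lambda>s. \<mu> s * frac_kernel \<alpha> (t - s)) has_integral (frac_kernel \<alpha> t - p t)) {0..t}"
    and mass: "((\<lambda>t. integral {0..t} \<mu>) \<longlongrightarrow> 1) at_top"

text \<open>
  The densities \<open>m\<^sub>b(s) = \<sigma>\<^bsup>\<alpha>\<^esup> s\<^bsup>b-1\<^esup> (\<sigma> + s)\<^bsup>-b-\<alpha>\<^esup> / B(b,\<alpha>)\<close> have mass \<open>1\<close> and satisfy \<open>m\<^sub>b * k = k w\<^bsup>b\<^esup>\<close> with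
  \<open>w(t) = t / (\<sigma> + t)\<close>. As \<open>1 - w\<^bsup>b\<^esup>\<close> is only of order \<open>1 / t\<close> at infinity, a single \<open>m\<^sub>b\<close> does not bound
  \<open>k - m\<^sub>b * k\<close> when \<open>\<alpha> > 1/2\<close>. In the combination \<open>\<mu> = (m\<^sub>\<alpha> - \<alpha> m\<^sub>1) / (1 - \<alpha>)\<close> the terms of order
  \<open>1 / t\<close> cancel, and \<open>\<mu>\<close> is still positive because \<open>\<alpha>\<^sup>2 B(\<alpha>,\<alpha>) < 1\<close>.
\<close>

lemma averaging_kernel_exists:
  fixes \<alpha> \<tau> :: real
  assumes \<alpha>: "0 < \<alpha>" "\<alpha> < 1" and \<tau>: "0 < \<tau>"
  obtains \<mu> p where "averaging_kernel \<alpha> \<tau> \<mu> p"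
proof -
  define B where "B = Beta \<alpha> \<alpha>"
  have G: "Gamma \<alpha> > 0" using \<alpha> by (simp add: Gamma_real_pos)
  have B: "B > 0" using \<alpha> by (simp add: B_def Beta_def Gamma_real_pos)
  have B1: "Beta 1 \<alpha> = 1 / \<alpha>"
    using G \<alpha> by (simp add: Beta_def Gamma_one_plus less_imp_neq[symmetric])
  \<comment> \<open>\<open>c\<close> is the constant in the lower bound
    \<open>c * (w s powr \<alpha> * u powr \<alpha> / s)\<close> for \<open>\<mu> s\<close>, where
    \<open>u = 1 - w s\<close>. It is positive by \<open>Beta_diagonal_less\<close>.\<close>
  define c where "c = (1 / B - \<alpha>^2) / (1 - \<alpha>)"
  have c: "c > 0"
    using Beta_diagonal_less[OF \<alpha>] B \<alpha> by (auto simp: c_def B_def[symmetric] field_simps)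
  \<comment> \<open>This scale makes \<open>\<sigma> powr \<alpha>\<close> cancel the
    \<open>Gamma \<alpha>\<close> of the fractional kernel and bring in exactly the factor
    \<open>\<tau> * c\<close> of the final bound.\<close>
  define \<sigma> where "\<sigma> = (\<tau> * c * Gamma \<alpha>) powr (1 / \<alpha>)"
  have \<sigma>: "\<sigma> > 0" "\<sigma> powr \<alpha> = \<tau> * c * Gamma \<alpha>"
    using \<alpha> \<tau> c G by (auto simp: \<sigma>_def powr_powr less_imp_neq[OF G, symmetric])
  define m where "m b s = \<sigma> powr \<alpha> / Beta b \<alpha> * (s powr (b - 1) * (\<sigma> + s) powr (- b - \<alpha>))" for b s
  define w where "w t = t / (\<sigma> + t)" for t
  define \<mu> where "\<mu> s = (if s = 0 then 0 else (m \<alpha> s - \<alpha> * m 1 s) / (1 - \<alpha>))" for s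
  \<comment> \<open>Closed form of the fractional kernel minus its convolution with
    \<open>\<mu>\<close>. The numerator is the gap between the power
    \<open>w s powr \<alpha>\<close> and its tangent at \<open>1\<close>, hence positive and of
    second order in \<open>1 - w s\<close>.\<close>
  define p where "p s = frac_kernel \<alpha> s * ((1 - w s powr \<alpha> - \<alpha> * (1 - w s)) / (1 - \<alpha>))" for s
  have Bb: "Beta b \<alpha> > 0" if "b > 0" for b using that \<alpha> by (simp add: Beta_def Gamma_real_pos)
  have w: "0 < w s" "w s < 1" if "s > 0" for s using that \<sigma> by (auto simp: w_def)
  have mconv: "((\<lambda>s. m b s * frac_kernel \<alpha> (t - s)) has_integral frac_kernel \<alpha> t * w t powr b) {0..t}"
    if "b > 0" "t > 0" for b t
  proof -
    have "((\<lambda>s. \<sigma> powr \<alpha> / Beta b \<alpha> / Gamma \<alpha> *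
        (s powr (b - 1) * (\<sigma> + s) powr (- b - \<alpha>) * (t - s) powr (\<alpha> - 1))) has_integral
      \<sigma> powr \<alpha> / Beta b \<alpha> / Gamma \<alpha> *
        (Beta b \<alpha> * t powr (b + \<alpha> - 1) * \<sigma> powr (- \<alpha>) * (\<sigma> + t) powr (- b))) {0..t}"
      by (intro has_integral_mult_right has_integral_beta_prime_conv that \<alpha> \<sigma>)
    moreover have "\<sigma> powr \<alpha> / Beta b \<alpha> / Gamma \<alpha> *
        (Beta b \<alpha> * t powr (b + \<alpha> - 1) * \<sigma> powr (- \<alpha>) * (\<sigma> + t) powr (- b)) = frac_kernel \<alpha> t * w t powr b"
      using that \<sigma>(1) Bb[of b] unfolding frac_kernel_def w_def
      by (simp add: powr_minus powr_divide powr_add powr_diff field_simps)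
    ultimately show ?thesis by (simp add: m_def frac_kernel_def mult_ac)
  qed
  have mint: "(m b has_integral
      integral {0..w t} (\<lambda>z. z powr (b - 1) * (1 - z) powr (\<alpha> - 1)) / Beta b \<alpha>) {0..t}"
    if "b > 0" "t > 0" for b t
    using has_integral_mult_right[OF has_integral_beta_prime[OF that(1) \<alpha>(1) \<sigma>(1) that(2)], of "1 / Beta b \<alpha>"]
    by (simp add: m_def[abs_def] w_def)
  have spike: "(g has_integral i) {0..t} \<Longrightarrow> (\<And>s. s > 0 \<Longrightarrow> f s = g s) \<Longrightarrow> (f has_integral i) {0..t}"
    for f g :: "real \<Rightarrow> real" and i t
    by (rule has_integral_spike_finite[of "{0}" _ f g]) auto
  have meas: "\<mu> \<in> borel_measurable borel" "p \<in> borel_measurable borel"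
    unfolding \<mu>_def[abs_def] p_def[abs_def] m_def frac_kernel_def w_def by measurable
  have zero: "\<mu> 0 = 0" "p 0 = 0" by (auto simp: \<mu>_def p_def frac_kernel_def)
  have pos: "0 < p s" and le: "p s \<le> \<tau> * \<mu> s" if s: "s > 0" for s
  proof -
    have K: "frac_kernel \<alpha> s > 0" using s G by (simp add: frac_kernel_def)
    show "0 < p s"
      using powr_less_tangent_one[OF \<alpha> w[OF s]] K \<alpha> by (simp add: p_def)
    define u where "u = 1 - w s"
    have u: "0 < u" "u < 1" "w s = 1 - u" using w[OF s] by (auto simp: u_def)
    have u': "u = \<sigma> / (\<sigma> + s)" using s \<sigma> by (simp add: u_def w_def field_simps)
    \<comment> \<open>The tangent inequality for the complementary exponent bounds
      \<open>w s powr \<alpha>\<close> from below by \<open>(1 - u) * (1 + (1 - \<alpha>) * u) = 1 -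
      \<alpha> * u - (1 - \<alpha>) * u^2\<close>, so the gap in \<open>p\<close> is at most
      \<open>(1 - \<alpha>) * u^2\<close>.\<close>
    have "w s powr (1 - \<alpha>) \<le> 1 - (1 - \<alpha>) * u"
      using powr_less_tangent_one[of "1 - \<alpha>" "w s"] w[OF s] \<alpha> by (simp add: u_def)
    then have "w s powr (1 - \<alpha>) * (1 + (1 - \<alpha>) * u) \<le> (1 - (1 - \<alpha>) * u) * (1 + (1 - \<alpha>) * u)"
      using u \<alpha> by (intro mult_right_mono) auto
    also have "\<dots> = 1 - ((1 - \<alpha>) * u)^2" by (simp add: algebra_simps power2_eq_square)
    also have "\<dots> \<le> 1" by simp
    finally have "w s powr \<alpha> * (w s powr (1 - \<alpha>) * (1 + (1 - \<alpha>) * u)) \<le> w s powr \<alpha> * 1"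
      by (intro mult_left_mono) auto
    then have "w s * (1 + (1 - \<alpha>) * u) \<le> w s powr \<alpha>"
      using w[OF s] by (simp add: mult.assoc[symmetric] powr_add[symmetric])
    then have "1 - w s powr \<alpha> - \<alpha> * (1 - w s) \<le> (1 - \<alpha>) * u^2"
      unfolding u(3) by (simp add: algebra_simps power2_eq_square)
    then have "p s \<le> frac_kernel \<alpha> s * u^2"
      unfolding p_def using K \<alpha> by (intro mult_left_mono) (auto simp: pos_divide_le_eq mult.commute)
    \<comment> \<open>Since \<open>s = w s * (\<sigma> / u)\<close>, the power
      \<open>s powr \<alpha>\<close> can be written in terms of \<open>w s\<close>, \<open>u\<close>
      and \<open>\<sigma> powr \<alpha>\<close>.\<close>
    also have "\<dots> = \<tau> * (c * (w s powr \<alpha> * u powr (2 - \<alpha>) / s))"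
    proof -
      have "s powr \<alpha> = w s powr \<alpha> * (\<sigma> / u) powr \<alpha>"
      proof -
        have "\<sigma> / u = \<sigma> + s" unfolding u' using s \<sigma> by simp
        then have "s = w s * (\<sigma> / u)" using s \<sigma> by (simp add: w_def)
        then show ?thesis using w[OF s] u \<sigma> by (metis powr_mult)
      qed
      also have "(\<sigma> / u) powr \<alpha> = \<tau> * c * Gamma \<alpha> / u powr \<alpha>"
        using u \<sigma> by (simp add: powr_divide)
      finally have sa: "s powr \<alpha> = w s powr \<alpha> * (\<tau> * c * Gamma \<alpha> / u powr \<alpha>)" .
      have "frac_kernel \<alpha> s = s powr \<alpha> / (s * Gamma \<alpha>)"
        using s by (simp add: frac_kernel_def powr_diff)
      moreover have "u^2 = u powr (2 - \<alpha>) * u powr \<alpha>" using u by (simp flip: powr_add)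
      ultimately show ?thesis using G u by (simp add: sa)
    qed
    also have "\<dots> \<le> \<tau> * (c * (w s powr \<alpha> * u powr \<alpha> / s))"
    proof -
      have "u powr (2 - \<alpha>) \<le> u powr \<alpha>" using u \<alpha> by (intro powr_mono') auto
      then show ?thesis using \<tau> c s
        by (intro mult_left_mono divide_right_mono) auto
    qed
    also have "\<dots> \<le> \<tau> * \<mu> s"
    proof -
      have m: "m b s = w s powr b * u powr \<alpha> / (s * Beta b \<alpha>)" if "b > 0" for b
      proof -
        have "\<sigma> powr \<alpha> / Beta b \<alpha> * (s powr (b - 1) * q powr (- b - \<alpha>))
            = (s / q) powr b * (\<sigma> / q) powr \<alpha> / (s * Beta b \<alpha>)" if "q > 0" for q
          using that s \<sigma> by (simp add: powr_divide powr_diff powr_minus field_simps)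
        from this[of "\<sigma> + s"] show ?thesis using s \<sigma> by (simp add: m_def w_def u')
      qed
      \<comment> \<open>The negative term of \<open>\<mu>\<close>, which carries
        \<open>\<alpha>^2\<close> because \<open>Beta 1 \<alpha> = 1 / \<alpha>\<close>, is absorbed
        into the first one at the cost of lowering \<open>1 / B\<close> to
        \<open>1 / B - \<alpha>^2\<close>.\<close>
      have "w s \<le> w s powr \<alpha>" using powr_mono'[of \<alpha> 1 "w s"] w[OF s] \<alpha> by simp
      then have "\<alpha>^2 * w s \<le> \<alpha>^2 * w s powr \<alpha>" by (intro mult_left_mono) auto
      then have "(w s powr \<alpha> * (1 / B - \<alpha>^2)) * (u powr \<alpha> / s / (1 - \<alpha>))
          \<le> (w s powr \<alpha> / B - \<alpha>^2 * w s) * (u powr \<alpha> / s / (1 - \<alpha>))"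
        using s \<alpha> by (intro mult_right_mono) (auto simp: algebra_simps)
      also have "\<dots> = \<mu> s"
        using s w[OF s] \<alpha> B by (simp add: \<mu>_def m B1 B_def[symmetric] field_simps power2_eq_square)
      finally show ?thesis using \<tau> \<alpha> by (intro mult_left_mono) (auto simp: c_def mult_ac)
    qed
    finally show "p s \<le> \<tau> * \<mu> s" .
  qed
  have int: "\<mu> integrable_on {0..t}" for t
  proof (cases "t > 0")
    case True
    show ?thesis
      by (rule has_integral_integrable, rule spike,
          rule has_integral_divide[OF has_integral_diff[OF mint[OF \<alpha>(1) True]
            has_integral_mult_right[OF mint[OF zero_less_one True], of \<alpha>]], of "1 - \<alpha>"])
        (simp add: \<mu>_def)
  next
    case False
    then have "{0..t} = {} \<or> {0..t} = {0}" by (cases "t = 0") auto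
    then show ?thesis using integrable_on_refl[of \<mu> 0] by auto
  qed
  \<comment> \<open>As \<open>w t\<close> tends to \<open>1\<close>, the incomplete Beta integrals
    become complete. Each \<open>m b\<close> therefore has mass \<open>1\<close>, and
    \<open>\<mu>\<close> has mass \<open>(1 - \<alpha>) / (1 - \<alpha>)\<close>.\<close>
  have mass: "((\<lambda>t. integral {0..t} \<mu>) \<longlongrightarrow> 1) at_top"
  proof -
    have Bint: "(\<lambda>z. z powr (b - 1) * (1 - z) powr (\<alpha> - 1)) integrable_on {0..1}" if "b > 0" for b
      by (rule integrable_Beta'[OF that \<alpha>(1)])
    have wlim: "(w \<longlongrightarrow> 1) at_top"
    proof -
      have "((\<lambda>t. \<sigma> / (\<sigma> + t)) \<longlongrightarrow> 0) at_top"
        by (intro real_tendsto_divide_at_top[OF tendsto_const]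
            filterlim_tendsto_add_at_top[OF tendsto_const filterlim_ident])
      then have "((\<lambda>t. 1 - \<sigma> / (\<sigma> + t)) \<longlongrightarrow> 1 - 0) at_top" by (intro tendsto_intros)
      moreover have "\<forall>\<^sub>F t in at_top. 1 - \<sigma> / (\<sigma> + t) = w t"
        using eventually_gt_at_top[of 0] by eventually_elim (use \<sigma> in \<open>auto simp: w_def field_simps\<close>)
      ultimately show ?thesis using Lim_transform_eventually by fastforce
    qed
    have lim: "((\<lambda>t. integral {0..w t} (\<lambda>z. z powr (b - 1) * (1 - z) powr (\<alpha> - 1)) / Beta b \<alpha>) \<longlongrightarrow> 1) at_top"
      if "b > 0" for b
    proof -
      let ?J = "\<lambda>x. integral {0..x} (\<lambda>z. z powr (b - 1) * (1 - z) powr (\<alpha> - 1))"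
      have "continuous_on {0..1} ?J" by (rule indefinite_integral_continuous_1[OF Bint[OF that]])
      then have "((\<lambda>t. ?J (w t)) \<longlongrightarrow> ?J 1) at_top"
        by (rule continuous_on_tendsto_compose[OF _ wlim])
          (use w in \<open>auto intro!: eventually_mono[OF eventually_gt_at_top[of 0]] less_imp_le\<close>)
      then have "((\<lambda>t. ?J (w t) / Beta b \<alpha>) \<longlongrightarrow> ?J 1 / Beta b \<alpha>) at_top"
        by (intro tendsto_intros) (use Bb[OF that] in auto)
      then show ?thesis using has_integral_Beta_real[OF that \<alpha>(1)] Bb[OF that] by (simp add: has_integral_iff)
    qed
    have "((\<lambda>t. (integral {0..w t} (\<lambda>z. z powr (\<alpha> - 1) * (1 - z) powr (\<alpha> - 1)) / Beta \<alpha> \<alpha>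
        - \<alpha> * (integral {0..w t} (\<lambda>z. z powr (1 - 1) * (1 - z) powr (\<alpha> - 1)) / Beta 1 \<alpha>)) / (1 - \<alpha>)) \<longlongrightarrow>
        (1 - \<alpha> * 1) / (1 - \<alpha>)) at_top"
      by (rule tendsto_divide[OF tendsto_diff[OF lim[OF \<alpha>(1)]
            tendsto_mult[OF tendsto_const lim[OF zero_less_one]]] tendsto_const]) (use \<alpha> in simp)
    moreover have "\<forall>\<^sub>F t in at_top. (integral {0..w t} (\<lambda>z. z powr (\<alpha> - 1) * (1 - z) powr (\<alpha> - 1)) / Beta \<alpha> \<alpha>
        - \<alpha> * (integral {0..w t} (\<lambda>z. z powr (1 - 1) * (1 - z) powr (\<alpha> - 1)) / Beta 1 \<alpha>)) / (1 - \<alpha>)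
        = integral {0..t} \<mu>"
      using eventually_gt_at_top[of 0]
    proof eventually_elim
      case (elim t)
      show ?case
        by (rule integral_unique[symmetric], rule spike,
            rule has_integral_divide[OF has_integral_diff[OF mint[OF \<alpha>(1) elim]
              has_integral_mult_right[OF mint[OF zero_less_one elim], of \<alpha>]], of "1 - \<alpha>"])
          (simp add: \<mu>_def)
    qed
    ultimately show "((\<lambda>t. integral {0..t} \<mu>) \<longlongrightarrow> 1) at_top"
      using \<alpha> Lim_transform_eventually by fastforce
  qed
  have conv: "((\<lambda>s. \<mu> s * frac_kernel \<alpha> (t - s)) has_integral (frac_kernel \<alpha> t - p t)) {0..t}"
    if t: "t > 0" for t
  proof -
    have eq: "(frac_kernel \<alpha> t * w t powr \<alpha> - \<alpha> * (frac_kernel \<alpha> t * w t powr 1)) / (1 - \<alpha>)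
        = frac_kernel \<alpha> t - p t"
      using \<alpha> w[OF t] by (simp add: p_def field_simps)
    have "((\<lambda>s. (m \<alpha> s * frac_kernel \<alpha> (t - s) - \<alpha> * (m 1 s * frac_kernel \<alpha> (t - s))) / (1 - \<alpha>)) has_integral
      (frac_kernel \<alpha> t * w t powr \<alpha> - \<alpha> * (frac_kernel \<alpha> t * w t powr 1)) / (1 - \<alpha>)) {0..t}"
      by (intro has_integral_divide has_integral_diff has_integral_mult_right mconv t) (use \<alpha> in auto)
    then show "((\<lambda>s. \<mu> s * frac_kernel \<alpha> (t - s)) has_integral (frac_kernel \<alpha> t - p t)) {0..t}"
      unfolding eq by (rule spike) (simp add: \<mu>_def diff_divide_distrib left_diff_distrib)
  qed
  have p_le: "p s \<le> \<tau> * \<mu> s" if "s \<ge> 0" for s using le[of s] zero that by (cases "s = 0") auto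
  have p_ge: "0 \<le> p s" if "s \<ge> 0" for s using pos[of s] zero that by (cases "s = 0") auto
  have \<mu>: "volterra_kernel \<mu>" unfolding volterra_kernel_def
  proof (intro conjI allI impI meas(1) int)
    fix v :: real assume "v \<ge> 0"
    then have "0 \<le> \<tau> * \<mu> v" using p_le p_ge by (meson order_trans)
    then show "0 \<le> \<mu> v" using \<tau> by (simp add: zero_le_mult_iff)
  qed
  have p: "volterra_kernel p" by (rule volterra_kernel_bound[OF \<mu> meas(2)]) (use p_le p_ge in blast)
  show ?thesis
    by (rule that, unfold_locales) (fact \<alpha> \<tau> \<mu> p pos zero p_le conv mass)+
qed

context averaging_kernel
begin

section \<open>From the Volterra equation to the averaged equation and back\<close>

abbreviation "k \<equiv> frac_kernel \<alpha>"
abbreviation "R t \<equiv> integral {0..t} \<mu>"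

lemma k: "volterra_kernel k"
  by (rule volterra_kernel_frac_kernel[OF \<alpha>(1)])

lemma \<mu>_conv': "t \<ge> 0 \<Longrightarrow> ((\<lambda>s. \<mu> s * k (t - s)) has_integral (k t - p t)) {0..t}"
  using \<mu>_conv by (cases "t = 0") (auto simp: frac_kernel_def p_0)

text \<open>Nonnegative because it is the convolution of the nonnegative kernels
  \<open>\<mu>\<close> and \<open>k\<close>.\<close>

lemma k_diff_p: "volterra_kernel (\<lambda>v. k v - p v)"
proof (rule volterra_kernel_bound[OF k, where C = 1])
  show "(\<lambda>v. k v - p v) \<in> borel_measurable borel"
    using volterra_kernelD(1)[OF k] volterra_kernelD(1)[OF p] by measurable
  show "0 \<le> k v - p v \<and> k v - p v \<le> 1 * k v" if "v \<ge> 0" for v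
    using has_integral_nonneg[OF \<mu>_conv'[OF that]] volterra_kernelD(2)[OF \<mu>] volterra_kernelD(2)[OF k]
      volterra_kernelD(2)[OF p that]
    by auto
qed

text \<open>As \<open>k\<close> is decreasing, \<open>R t * k t\<close> is at most the convolution
  of \<open>\<mu>\<close> and \<open>k\<close> at \<open>t\<close>, that is
  \<open>k t - p t\<close>, which is less than \<open>k t\<close>.\<close>

lemma R_less_1: "R t < 1"
proof (cases "t > 0")
  case True
  have kt: "k t > 0" using True Gamma_real_pos[OF \<alpha>(1)] by (simp add: frac_kernel_def)
  have "R t * k t \<le> k t - p t"
  proof (rule has_integral_le)
    show "((\<lambda>s. \<mu> s * k t) has_integral R t * k t) {0<..<t}"
      using has_integral_mult_left[OF integrable_integral[OF volterra_kernelD(3)[OF \<mu>]]]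
      by (simp flip: has_integral_Icc_iff_Ioo)
    show "((\<lambda>s. \<mu> s * k (t - s)) has_integral (k t - p t)) {0<..<t}"
      using \<mu>_conv[OF True] by (simp flip: has_integral_Icc_iff_Ioo)
    show "\<mu> s * k t \<le> \<mu> s * k (t - s)" if "s \<in> {0<..<t}" for s
    proof -
      have "t powr (\<alpha> - 1) \<le> (t - s) powr (\<alpha> - 1)"
        using that \<alpha> by (intro powr_mono2') auto
      then have "k t \<le> k (t - s)"
        using Gamma_real_pos[OF \<alpha>(1)] by (simp add: frac_kernel_def divide_right_mono)
      then show ?thesis using volterra_kernelD(2)[OF \<mu>, of s] that by (auto intro: mult_left_mono)
    qed
  qed
  then have "R t * k t < 1 * k t" using p_pos[OF True] by simp
  then show ?thesis using kt by (simp only: mult_less_cancel_right_pos)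
next
  case False
  then have "{0..t} = {} \<or> {0..t} = {0}" by (cases "t = 0") auto
  then show ?thesis by auto
qed

text \<open>This positive mass is what brings the contraction factor \<open>q\<close> below
  \<open>1\<close>.\<close>

lemma P_pos: "0 < integral {0..1} p"
proof -
  have "integral {0..1} p \<noteq> 0"
  proof
    assume 0: "integral {0..1} p = 0"
    have int: "set_integrable lborel {0..1} p"
      by (intro set_integrable_lborelI volterra_kernelD p) auto
    have "AE x in lborel. indicator {0..1} x *\<^sub>R p x = 0"
    proof (subst integral_nonneg_eq_0_iff_AE[symmetric])
      show "(\<integral>x. indicator {0..1} x *\<^sub>R p x \<partial>lborel) = 0"
        using set_borel_integral_eq_integral(2)[OF int] 0 by (simp add: set_lebesgue_integral_def)
      show "AE x in lborel. 0 \<le> indicat_real {0..1} x *\<^sub>R p x"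
        using volterra_kernelD(2)[OF p] by (auto simp: indicator_def)
    qed (use int in \<open>simp add: set_integrable_def\<close>)
    then have "AE x in lborel. x \<notin> {0<..<1::real}"
      by eventually_elim (use p_pos in \<open>fastforce simp: indicator_def\<close>)
    then have "{0<..<1::real} \<in> null_sets lborel" by (subst AE_iff_null_sets) auto
    then show False by (simp add: null_sets_def)
  qed
  moreover have "0 \<le> integral {0..1} p"
    using volterra_kernelD(2)[OF p] by (intro integral_nonneg volterra_kernelD(3)[OF p]) auto
  ultimately show ?thesis by simp
qed

text \<open>Averaging the Volterra equation with \<open>\<mu>\<close> gives
  \<open>conv \<mu> x t = R t *\<^sub>R x0 + conv k h t - conv p h t\<close> by associativity; this
  is solved for \<open>conv k h t\<close> and inserted into the equation.\<close>

lemma averaged_of_volterra: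
  fixes x h :: "real \<Rightarrow> 'a::euclidean_space"
  assumes x: "continuous_on UNIV x" and h: "continuous_on UNIV h"
    and eq: "\<And>s. s \<ge> 0 \<Longrightarrow> x s = x0 + conv k h s" and t: "t \<ge> 0"
  shows "x t = (1 - R t) *\<^sub>R x0 + conv \<mu> x t + conv p h t"
proof -
  have c: "continuous_on UNIV (\<lambda>s. conv k h (max 0 s))"
    by (intro continuous_on_compose2[OF continuous_on_conv[OF k h]] continuous_intros) auto
  have "conv \<mu> x t = conv \<mu> (\<lambda>s. x0 + conv k h (max 0 s)) t"
    by (rule conv_cong) (use eq in auto)
  also have "\<dots> = R t *\<^sub>R x0 + conv \<mu> (\<lambda>s. conv k h (max 0 s)) t"
    by (subst conv_add[OF \<mu> _ c]) (auto simp: conv_const[OF \<mu>])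
  also have "conv \<mu> (\<lambda>s. conv k h (max 0 s)) t = conv \<mu> (conv k h) t"
    by (rule conv_cong) auto
  also have "\<dots> = conv k h t - conv p h t"
    using conv_assoc[OF \<mu> k k_diff_p \<mu>_conv' h t] conv_kernel_diff[OF k p h] by simp
  finally show ?thesis using eq[OF t] by (simp add: algebra_simps)
qed

text \<open>The right-hand side \<open>y\<close> of the Volterra equation satisfies the averaged
  equation with the same \<open>h\<close>, so \<open>u = x - y\<close> equals its own average
  \<open>conv \<mu> u\<close>. Where \<open>norm (u s)\<close> is maximal on \<open>{0..t}\<close>,
  the bound \<open>R s < 1\<close> forces it to vanish.\<close>

lemma volterra_of_averaged:
  fixes x h :: "real \<Rightarrow> 'a::euclidean_space"
  assumes x: "continuous_on UNIV x" and h: "continuous_on UNIV h"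
    and eq: "\<And>s. s \<ge> 0 \<Longrightarrow> x s = (1 - R s) *\<^sub>R x0 + conv \<mu> x s + conv p h s" and t: "t \<ge> 0"
  shows "x t = x0 + conv k h t"
proof -
  define y where "y s = x0 + conv k h (max 0 s)" for s
  define u where "u s = x s - y s" for s
  have c: "continuous_on UNIV (\<lambda>s. conv k h (max 0 s))"
    by (intro continuous_on_compose2[OF continuous_on_conv[OF k h]] continuous_intros) auto
  then have y: "continuous_on UNIV y" unfolding y_def by (intro continuous_intros)
  then have u: "continuous_on UNIV u" unfolding u_def using x by (intro continuous_intros)
  have ueq: "u s = conv \<mu> u s" if "s \<ge> 0" for s
    using eq[OF that] averaged_of_volterra[OF y h _ that] conv_diff[OF \<mu> x y, of s]
    by (simp add: u_def[abs_def] y_def)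
  obtain s where s: "s \<in> {0..t}" "\<And>v. v \<in> {0..t} \<Longrightarrow> norm (u v) \<le> norm (u s)"
  proof -
    have "continuous_on {0..t} (\<lambda>s. norm (u s))"
      using continuous_on_subset[OF u] by (auto intro!: continuous_intros)
    then show ?thesis using continuous_attains_sup[of "{0..t}" "\<lambda>s. norm (u s)"] t that by auto
  qed
  have "norm (conv \<mu> u s) \<le> integral {0..s} (\<lambda>v. \<mu> v * norm (u s))"
    unfolding conv_def
  proof (rule Henstock_Kurzweil_Integration.integral_norm_bound_integral)
    show "(\<lambda>v. \<mu> v *\<^sub>R u (s - v)) integrable_on {0..s}" by (rule conv_integrable[OF \<mu> u])
    show "(\<lambda>v. \<mu> v * norm (u s)) integrable_on {0..s}"
      by (intro integrable_on_mult_left volterra_kernelD(3)[OF \<mu>])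
    show "norm (\<mu> v *\<^sub>R u (s - v)) \<le> \<mu> v * norm (u s)" if "v \<in> {0..s}" for v
      using s(2)[of "s - v"] s(1) that volterra_kernelD(2)[OF \<mu>, of v] by (auto intro: mult_left_mono)
  qed
  also have "\<dots> = R s * norm (u s)" by simp
  finally have "norm (u s) \<le> R s * norm (u s)" using ueq[of s] s(1) by simp
  then have "(1 - R s) * norm (u s) \<le> 0" by (simp add: algebra_simps)
  then have "norm (u s) \<le> 0" using R_less_1[of s] by (simp add: mult_le_0_iff)
  then have "u t = 0" using s(2)[of t] t by simp
  then show ?thesis using t by (simp add: u_def y_def)
qed

end

section \<open>Contracting Euler steps\<close>

text \<open>\<open>contr\<close> compares two Euler steps of the same length \<open>h\<close>;
  \<open>c * \<tau> \<le> 1\<close> keeps the factor \<open>1 - c * h\<close> nonnegative.\<close>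

locale euler_contraction = averaging_kernel +
  fixes f :: "'a::euclidean_space \<Rightarrow> 'a" and c \<rho> :: real
  assumes c: "0 < c" "c * \<tau> \<le> 1" and f_cont: "continuous_on UNIV f" and f_0: "f 0 = 0" and \<rho>: "0 < \<rho>"
    and contr: "\<And>x y h. x \<in> cball 0 \<rho> \<Longrightarrow> y \<in> cball 0 \<rho> \<Longrightarrow> 0 \<le> h \<Longrightarrow> h \<le> \<tau> \<Longrightarrow>
      norm (x + h *\<^sub>R f x - (y + h *\<^sub>R f y)) \<le> (1 - c * h) * norm (x - y)"
begin

text \<open>\<open>\<mu> v\<close> times the contraction factor \<open>1 - c * h\<close> of the
  Euler step of length \<open>h = p v / \<mu> v\<close>.\<close>

definition \<kappa> :: "real \<Rightarrow> real" where "\<kappa> v = \<mu> v - c * p v"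

text \<open>A bound for the mass of \<open>\<kappa>\<close> that is uniform in time.\<close>

definition q :: real where "q = 1 - c * integral {0..1} p"

lemma \<kappa>: "v \<ge> 0 \<Longrightarrow> 0 \<le> \<kappa> v" "v \<ge> 0 \<Longrightarrow> \<kappa> v \<le> \<mu> v" "\<kappa> integrable_on {0..t}"
proof -
  show "0 \<le> \<kappa> v" if "v \<ge> 0"
  proof -
    have "c * p v \<le> c * (\<tau> * \<mu> v)" using p_le[OF that] c by simp
    also have "\<dots> \<le> 1 * \<mu> v"
      using mult_right_mono[OF c(2) volterra_kernelD(2)[OF \<mu> that]] by (simp add: mult_ac)
    finally show ?thesis by (simp add: \<kappa>_def)
  qed
  show "\<kappa> v \<le> \<mu> v" if "v \<ge> 0" using volterra_kernelD(2)[OF p that] c by (simp add: \<kappa>_def)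
  show "\<kappa> integrable_on {0..t}" unfolding \<kappa>_def[abs_def]
    by (intro integrable_diff integrable_on_mult_right volterra_kernelD(3) \<mu> p)
qed

lemma \<kappa>_volterra: "volterra_kernel \<kappa>"
  using \<kappa>(1,3) volterra_kernelD(1)[OF \<mu>] volterra_kernelD(1)[OF p]
  unfolding volterra_kernel_def \<kappa>_def[abs_def] by auto

lemma q_less_1: "q < 1"
  using P_pos c by (simp add: q_def)

text \<open>For the second bound, times up to \<open>1\<close> reduce to \<open>t = 1\<close> by
  monotonicity. Later, \<open>c * integral {0..t} p\<close> is at least its value at
  \<open>1\<close>, while \<open>R t < 1\<close>.\<close>

lemma \<kappa>_integral_le: "integral {0..t} \<kappa> \<le> R t" "integral {0..t} \<kappa> \<le> q"
proof -
  have cp: "(\<lambda>v. c * p v) integrable_on {0..t}" for t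
    by (rule integrable_on_mult_right[OF volterra_kernelD(3)[OF p]])
  have eq: "integral {0..t} \<kappa> = R t - c * integral {0..t} p" for t
    unfolding \<kappa>_def[abs_def] using integral_diff[OF volterra_kernelD(3)[OF \<mu>] cp] by simp
  show "integral {0..t} \<kappa> \<le> R t"
    using \<kappa>(2,3) volterra_kernelD(3)[OF \<mu>] by (intro integral_le) auto
  show "integral {0..t} \<kappa> \<le> q"
  proof (cases "t \<le> 1")
    case True
    then have "integral {0..t} \<kappa> \<le> integral {0..1} \<kappa>"
      using \<kappa> by (intro integral_subset_le) auto
    also have "\<dots> \<le> q" unfolding eq q_def using R_less_1[of 1] by simp
    finally show ?thesis .
  next
    case False
    then have "integral {0..1} p \<le> integral {0..t} p"
      using volterra_kernelD[OF p] by (intro integral_subset_le) auto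
    then have "c * integral {0..1} p \<le> c * integral {0..t} p" using c by simp
    then show ?thesis unfolding eq q_def using R_less_1[of t] by linarith
  qed
qed

lemma q_nonneg: "0 \<le> q"
  using \<kappa>_integral_le(2)[of 0] by simp

text \<open>Dividing by \<open>\<mu> v\<close> leaves the difference of two Euler steps of length
  \<open>p v / \<mu> v \<le> \<tau>\<close>; where \<open>\<mu> v = 0\<close>, also
  \<open>p v = 0\<close>.\<close>

lemma step_bound:
  assumes "x \<in> cball 0 \<rho>" "y \<in> cball 0 \<rho>" "v \<ge> 0"
  shows "norm (\<mu> v *\<^sub>R (x - y) + p v *\<^sub>R (f x - f y)) \<le> \<kappa> v * norm (x - y)"
proof (cases "\<mu> v = 0")
  case True
  then have "p v = 0" using p_le[OF assms(3)] volterra_kernelD(2)[OF p assms(3)] by simp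
  then show ?thesis using True by (simp add: \<kappa>_def)
next
  case False
  then have pos: "\<mu> v > 0" using volterra_kernelD(2)[OF \<mu> assms(3)] by simp
  define h where "h = p v / \<mu> v"
  have h: "0 \<le> h" "h \<le> \<tau>" "p v = \<mu> v * h"
    using pos p_le[OF assms(3)] volterra_kernelD(2)[OF p assms(3)] by (auto simp: h_def field_simps)
  have "\<mu> v *\<^sub>R (x - y) + p v *\<^sub>R (f x - f y) = \<mu> v *\<^sub>R (x + h *\<^sub>R f x - (y + h *\<^sub>R f y))"
    by (simp add: h(3) algebra_simps)
  then have "norm (\<mu> v *\<^sub>R (x - y) + p v *\<^sub>R (f x - f y)) = \<mu> v * norm (x + h *\<^sub>R f x - (y + h *\<^sub>R f y))"
    using pos by simp
  also have "\<dots> \<le> \<mu> v * ((1 - c * h) * norm (x - y))"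
    using pos contr[OF assms(1,2) h(1,2)] by simp
  also have "\<dots> = \<kappa> v * norm (x - y)" by (simp add: \<kappa>_def h(3) algebra_simps)
  finally show ?thesis .
qed

lemma conv_step_bound:
  assumes x: "continuous_on UNIV x" and y: "continuous_on UNIV y"
    and ball: "\<And>s. s \<in> {0..t} \<Longrightarrow> x s \<in> cball 0 \<rho>" "\<And>s. s \<in> {0..t} \<Longrightarrow> y s \<in> cball 0 \<rho>"
  shows "norm (conv \<mu> x t - conv \<mu> y t + (conv p (\<lambda>s. f (x s)) t - conv p (\<lambda>s. f (y s)) t))
    \<le> conv \<kappa> (\<lambda>s. norm (x s - y s)) t"
proof -
  have fx: "continuous_on UNIV (\<lambda>s. f (x s))" and fy: "continuous_on UNIV (\<lambda>s. f (y s))"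
    by (rule continuous_on_compose2[OF f_cont x subset_UNIV] continuous_on_compose2[OF f_cont y subset_UNIV])+
  let ?d = "\<lambda>v. \<mu> v *\<^sub>R (x (t - v) - y (t - v))" and ?e = "\<lambda>v. p v *\<^sub>R (f (x (t - v)) - f (y (t - v)))"
  have i: "?d integrable_on {0..t}" "?e integrable_on {0..t}"
    using conv_integrable[OF \<mu> continuous_on_diff[OF x y]] conv_integrable[OF p continuous_on_diff[OF fx fy]]
    by blast+
  have eq: "conv \<mu> x t - conv \<mu> y t + (conv p (\<lambda>s. f (x s)) t - conv p (\<lambda>s. f (y s)) t)
      = integral {0..t} (\<lambda>v. ?d v + ?e v)"
    unfolding integral_add[OF i] conv_diff[OF \<mu> x y, symmetric] conv_diff[OF p fx fy, symmetric]
    unfolding conv_def ..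
  have "norm (integral {0..t} (\<lambda>v. ?d v + ?e v)) \<le> integral {0..t} (\<lambda>v. \<kappa> v *\<^sub>R norm (x (t - v) - y (t - v)))"
  proof (rule Henstock_Kurzweil_Integration.integral_norm_bound_integral)
    show "(\<lambda>v. ?d v + ?e v) integrable_on {0..t}" by (rule integrable_add[OF i])
    show "(\<lambda>v. \<kappa> v *\<^sub>R norm (x (t - v) - y (t - v))) integrable_on {0..t}"
      by (rule conv_integrable[OF \<kappa>_volterra continuous_on_norm[OF continuous_on_diff[OF x y]]])
    show "norm (?d v + ?e v) \<le> \<kappa> v *\<^sub>R norm (x (t - v) - y (t - v))" if "v \<in> {0..t}" for v
      using step_bound[OF ball, of "t - v" "t - v" v] that unfolding real_scaleR_def by auto
  qed
  then show ?thesis unfolding eq unfolding conv_def .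
qed

lemma conv_\<kappa>_le:
  assumes "continuous_on UNIV g" "\<And>s. s \<in> {0..t} \<Longrightarrow> g s \<le> D"
  shows "conv \<kappa> g t \<le> integral {0..t} \<kappa> * D"
proof -
  have "integral {0..t} (\<lambda>v. \<kappa> v *\<^sub>R g (t - v)) \<le> integral {0..t} (\<lambda>v. \<kappa> v * D)"
  proof (rule integral_le)
    show "(\<lambda>v. \<kappa> v *\<^sub>R g (t - v)) integrable_on {0..t}" by (rule conv_integrable[OF \<kappa>_volterra assms(1)])
    show "(\<lambda>v. \<kappa> v * D) integrable_on {0..t}" by (rule integrable_on_mult_left[OF \<kappa>(3)])
    show "\<kappa> v *\<^sub>R g (t - v) \<le> \<kappa> v * D" if "v \<in> {0..t}" for v
    proof -
      have "0 \<le> \<kappa> v" "g (t - v) \<le> D" using that by (auto intro!: \<kappa>(1) assms(2))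
      then show ?thesis unfolding real_scaleR_def by (intro mult_left_mono)
    qed
  qed
  then show ?thesis by (simp only: conv_def Henstock_Kurzweil_Integration.integral_mult_left)
qed

text \<open>Comparison with the zero function in \<open>conv_step_bound\<close>, using
  \<open>f 0 = 0\<close>.\<close>

lemma norm_averaged_le:
  assumes x: "continuous_on UNIV x" and ball: "\<And>s. s \<in> {0..t} \<Longrightarrow> x s \<in> cball 0 \<rho>"
  shows "norm (conv \<mu> x t + conv p (\<lambda>s. f (x s)) t) \<le> conv \<kappa> (\<lambda>s. norm (x s)) t"
proof -
  have z: "conv \<mu> (\<lambda>s. 0::'a) t = 0" "conv p (\<lambda>s. 0::'a) t = 0" by (simp_all add: conv_def)
  have "norm (conv \<mu> x t - conv \<mu> (\<lambda>s. 0) t + (conv p (\<lambda>s. f (x s)) t - conv p (\<lambda>s. f 0) t))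
      \<le> conv \<kappa> (\<lambda>s. norm (x s - 0)) t"
    using \<rho> by (intro conv_step_bound x ball continuous_on_const) auto
  then show ?thesis unfolding f_0 z diff_zero .
qed

section \<open>Solutions that start in the ball\<close>

abbreviation "solution x0 x \<equiv> caputo_ivp_solution \<alpha> f x0 x"

lemma solution_averaged:
  assumes "solution x0 x" "t \<ge> 0"
  shows "x t = (1 - R t) *\<^sub>R x0 + conv \<mu> (\<lambda>s. x (max 0 s)) t + conv p (\<lambda>s. f (x (max 0 s))) t"
    and "continuous_on UNIV (\<lambda>s. x (max 0 s))"
proof -
  have x: "continuous_on {0..} x" using assms by (simp add: caputo_ivp_solution_def)
  show y: "continuous_on UNIV (\<lambda>s. x (max 0 s))"
    by (intro continuous_on_compose2[OF x] continuous_intros) auto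
  have h: "continuous_on UNIV (\<lambda>s. f (x (max 0 s)))"
    by (rule continuous_on_compose2[OF f_cont y subset_UNIV])
  have "x (max 0 s) = x0 + conv k (\<lambda>s. f (x (max 0 s))) s" if "s \<ge> 0" for s
  proof -
    have "x s = x0 + conv k (\<lambda>s. f (x s)) s"
      using assms that RL_integral_eq_conv[OF that \<alpha>(1), of "\<lambda>s. f (x s)"]
      by (simp add: caputo_ivp_solution_def)
    also have "conv k (\<lambda>s. f (x s)) s = conv k (\<lambda>s. f (x (max 0 s))) s"
      by (rule conv_cong) auto
    finally show ?thesis using that by simp
  qed
  from averaged_of_volterra[OF y h this assms(2)] assms(2)
  show "x t = (1 - R t) *\<^sub>R x0 + conv \<mu> (\<lambda>s. x (max 0 s)) t + conv p (\<lambda>s. f (x (max 0 s))) t"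
    by simp
qed

lemma solution_norm_le:
  assumes sol: "solution x0 x" and t: "t \<ge> 0" and ball: "\<And>s. s \<in> {0..t} \<Longrightarrow> norm (x s) \<le> \<rho>"
  shows "norm (x t) \<le> (1 - R t) * norm x0 + conv \<kappa> (\<lambda>s. norm (x (max 0 s))) t"
proof -
  let ?c = "conv \<mu> (\<lambda>s. x (max 0 s)) t + conv p (\<lambda>s. f (x (max 0 s))) t"
  have "norm (x t) = norm ((1 - R t) *\<^sub>R x0 + ?c)"
    using solution_averaged(1)[OF sol t] by (simp add: add.assoc)
  moreover have "norm ((1 - R t) *\<^sub>R x0 + ?c) \<le> norm ((1 - R t) *\<^sub>R x0) + norm ?c"
    by (rule norm_triangle_ineq)
  moreover have "norm ?c \<le> conv \<kappa> (\<lambda>s. norm (x (max 0 s))) t"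
    using ball by (intro norm_averaged_le solution_averaged(2)[OF sol t]) auto
  moreover have "norm ((1 - R t) *\<^sub>R x0) = (1 - R t) * norm x0" using R_less_1[of t] by simp
  ultimately show ?thesis by linarith
qed

text \<open>A first-exit argument. At the first time \<open>T\<close> with
  \<open>r \<le> norm (x T)\<close> all values up to \<open>T\<close> have norm at most
  \<open>r\<close>, so \<open>norm (x T) \<le> (1 - R T) * norm x0 + R T * r\<close>, which is less
  than \<open>r\<close> because \<open>R T < 1\<close>.\<close>

lemma solution_bounded:
  assumes sol: "solution x0 x" and r: "norm x0 < r" "r \<le> \<rho>" and t: "t \<ge> 0"
  shows "norm (x t) < r"
proof (rule ccontr)
  assume "\<not> norm (x t) < r"
  define A where "A = {s \<in> {0..t}. r \<le> norm (x s)}"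
  have xc: "continuous_on {0..t} x"
    using sol by (auto simp: caputo_ivp_solution_def intro: continuous_on_subset)
  have "closed A" unfolding A_def
    by (rule continuous_on_closed_Collect_le[OF continuous_on_const continuous_on_norm[OF xc]]) auto
  then have "compact ({0..t} \<inter> A)" by (rule compact_Int_closed[OF compact_Icc])
  moreover have "{0..t} \<inter> A = A" by (auto simp: A_def)
  ultimately have "compact A" by simp
  moreover have "t \<in> A" using t \<open>\<not> norm (x t) < r\<close> by (simp add: A_def)
  ultimately obtain T where T: "T \<in> A" "\<And>s. s \<in> A \<Longrightarrow> T \<le> s"
    using compact_attains_inf[of A] by blast
  have x0: "x 0 = x0" using solution_averaged(1)[OF sol, of 0] by simp
  have T0: "0 < T" "T \<le> t" using T(1) r x0 by (auto simp: A_def) (metis less_eq_real_def not_le)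
  have before: "norm (x s) < r" if "s \<in> {0..<T}" for s
    using T(2)[of s] that T0 by (force simp: A_def)
  have "norm (x T) \<le> r"
  proof (rule continuous_le_on_closure[of "{0..<T}" "\<lambda>s. norm (x s)"])
    show "continuous_on (closure {0..<T}) (\<lambda>s. norm (x s))"
      using T0 by (auto intro!: continuous_intros continuous_on_subset[OF xc])
  qed (use T0 before in \<open>auto intro: less_imp_le\<close>)
  then have ball: "norm (x s) \<le> r" if "s \<in> {0..T}" for s
    using before[of s] that by (cases "s = T") auto
  have y: "continuous_on UNIV (\<lambda>s. norm (x (max 0 s)))"
    using solution_averaged(2)[OF sol t] by (intro continuous_intros)
  have "norm (x T) \<le> (1 - R T) * norm x0 + conv \<kappa> (\<lambda>s. norm (x (max 0 s))) T"
    using ball r T0 by (intro solution_norm_le[OF sol]) (auto intro: order_trans)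
  moreover have "conv \<kappa> (\<lambda>s. norm (x (max 0 s))) T \<le> integral {0..T} \<kappa> * r"
    using ball by (intro conv_\<kappa>_le y) auto
  moreover have "integral {0..T} \<kappa> * r \<le> R T * r"
    using \<kappa>_integral_le(1)[of T] r norm_ge_zero[of x0] by (intro mult_right_mono) linarith+
  moreover have "(1 - R T) * norm x0 < (1 - R T) * r"
    using R_less_1[of T] r by simp
  moreover have "r \<le> norm (x T)" using T(1) by (simp add: A_def)
  ultimately show False by (simp add: left_diff_distrib)
qed

text \<open>Let the norm be at most \<open>M\<close> from time \<open>T\<close> on, and split the
  convolution at \<open>v = t - T\<close>. The part that sees times after \<open>T\<close> is at
  most \<open>q * M\<close>. The part that sees earlier times and the initial term add up to at most
  \<open>\<rho> * (1 - R (t - T))\<close>, which tends to \<open>0\<close> because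
  \<open>\<mu>\<close> has mass \<open>1\<close>.\<close>

lemma solution_decay_step:
  assumes sol: "solution x0 x" and x0: "norm x0 < \<rho>" and M: "0 < M" and q': "q < q'"
    and ev: "\<forall>\<^sub>F t in at_top. norm (x t) \<le> M"
  shows "\<forall>\<^sub>F t in at_top. norm (x t) \<le> q' * M"
proof -
  obtain T where T: "T \<ge> 0" "\<And>t. t \<ge> T \<Longrightarrow> norm (x t) \<le> M"
    using ev unfolding eventually_at_top_linorder by (metis max.cobounded1 max.bounded_iff max.cobounded2)
  have b: "norm (x s) \<le> \<rho>" if "s \<ge> 0" for s using solution_bounded[OF sol x0 order_refl that] by simp
  have y: "continuous_on UNIV (\<lambda>s. norm (x (max 0 s)))"
    using solution_averaged(2)[OF sol order_refl] by (intro continuous_intros)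
  have bound: "norm (x t) \<le> q * M + \<rho> * (1 - R (t - T))" if t: "t \<ge> T" for t
  proof -
    let ?g = "\<lambda>v. \<kappa> v *\<^sub>R norm (x (max 0 (t - v)))"
    have gi: "?g integrable_on {0..t}" by (rule conv_integrable[OF \<kappa>_volterra y])
    have \<mu>i: "\<mu> integrable_on {0..t}" by (rule volterra_kernelD(3)[OF \<mu>])
    have 1: "integral {0..t - T} ?g \<le> integral {0..t - T} (\<lambda>v. \<kappa> v * M)"
    proof (rule integral_le)
      show "?g integrable_on {0..t - T}" by (rule integrable_on_subinterval[OF gi]) (use T in auto)
      show "(\<lambda>v. \<kappa> v * M) integrable_on {0..t - T}" by (intro integrable_on_mult_left \<kappa>)
        show "?g v \<le> \<kappa> v * M" if "v \<in> {0..t - T}" for v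
      proof -
        have "0 \<le> \<kappa> v" "norm (x (max 0 (t - v))) \<le> M" using that T by (auto intro!: \<kappa>(1))
        then show ?thesis unfolding real_scaleR_def by (intro mult_left_mono)
      qed
    qed
    have 2: "integral {t - T..t} ?g \<le> integral {t - T..t} (\<lambda>v. \<mu> v * \<rho>)"
    proof (rule integral_le)
      show "?g integrable_on {t - T..t}" by (rule integrable_on_subinterval[OF gi]) (use t in auto)
      show "(\<lambda>v. \<mu> v * \<rho>) integrable_on {t - T..t}"
        by (intro integrable_on_mult_left integrable_on_subinterval[OF \<mu>i]) (use t in auto)
      show "?g v \<le> \<mu> v * \<rho>" if "v \<in> {t - T..t}" for v
        using that t \<kappa>(1,2)[of v] b[of "max 0 (t - v)"] unfolding real_scaleR_def
        by (intro mult_mono) auto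
    qed
    have "R t = R (t - T) + integral {t - T..t} \<mu>"
      using Henstock_Kurzweil_Integration.integral_combine[OF _ _ \<mu>i, of "t - T"] t T by simp
    then have 3: "integral {t - T..t} (\<lambda>v. \<mu> v * \<rho>) = \<rho> * (R t - R (t - T))" by simp
    have 4: "integral {0..t - T} (\<lambda>v. \<kappa> v * M) \<le> q * M"
      using \<kappa>_integral_le(2)[of "t - T"] M by simp
    have 5: "norm (x t) \<le> (1 - R t) * norm x0 + conv \<kappa> (\<lambda>s. norm (x (max 0 s))) t"
      using b T t by (intro solution_norm_le[OF sol]) auto
    have 6: "conv \<kappa> (\<lambda>s. norm (x (max 0 s))) t = integral {0..t - T} ?g + integral {t - T..t} ?g"
      unfolding conv_def
      using Henstock_Kurzweil_Integration.integral_combine[OF _ _ gi, of "t - T"] t T by simp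
    have 7: "(1 - R t) * norm x0 \<le> (1 - R t) * \<rho>"
      using R_less_1[of t] x0 by (intro mult_left_mono) auto
    show ?thesis using 1 2 3 4 5 6 7 by (simp add: algebra_simps)
  qed
  have "((\<lambda>t. q * M + \<rho> * (1 - R (t - T))) \<longlongrightarrow> q * M + \<rho> * (1 - 1)) at_top"
  proof -
    have "filterlim (\<lambda>t. t - T) at_top at_top"
      using filterlim_tendsto_add_at_top[OF tendsto_const[of "-T"] filterlim_ident] by simp
    then have "((\<lambda>t. R (t - T)) \<longlongrightarrow> 1) at_top" by (rule filterlim_compose[OF mass])
    then show ?thesis by (intro tendsto_add tendsto_mult tendsto_diff tendsto_const)
  qed
  moreover have "q * M + \<rho> * (1 - 1) < q' * M" using q' M by simp
  ultimately have "\<forall>\<^sub>F t in at_top. q * M + \<rho> * (1 - R (t - T)) < q' * M" by (rule order_tendstoD)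
  with eventually_ge_at_top[of T] show ?thesis
    by eventually_elim (use bound in \<open>auto intro: order_trans less_imp_le\<close>)
qed

lemma solution_tendsto_0:
  assumes sol: "solution x0 x" and x0: "norm x0 < \<rho>"
  shows "((\<lambda>t. norm (x t)) \<longlongrightarrow> 0) at_top"
proof -
  \<comment> \<open>A factor strictly between \<open>q\<close> and \<open>1\<close>, positive even
    if \<open>q = 0\<close>. The decay step is iterated with it, starting from the bound
    \<open>\<rho>\<close>.\<close>
  define q' where "q' = (1 + q) / 2"
  have q': "q < q'" "0 < q'" "q' < 1" using q_less_1 q_nonneg by (auto simp: q'_def)
  have ev: "\<forall>\<^sub>F t in at_top. norm (x t) \<le> q' ^ n * \<rho>" for n
  proof (induction n)
    case 0
    show ?case using eventually_ge_at_top[of 0]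
      by eventually_elim (use solution_bounded[OF sol x0 order_refl] in \<open>auto intro: less_imp_le\<close>)
  next
    case (Suc n)
    then show ?case
      using solution_decay_step[OF sol x0 _ q'(1) Suc] q' \<rho> by (simp add: mult.assoc)
  qed
  show ?thesis
  proof (rule tendstoI)
    fix e :: real assume e: "e > 0"
    have "(\<lambda>n. q' ^ n * \<rho>) \<longlonglongrightarrow> 0 * \<rho>"
      using q' by (intro tendsto_intros LIMSEQ_realpow_zero) auto
    then have "\<forall>\<^sub>F n in sequentially. q' ^ n * \<rho> < e" using e by (intro order_tendstoD) auto
    then obtain n where "q' ^ n * \<rho> < e" by (auto simp: eventually_sequentially)
    with ev[of n] show "\<forall>\<^sub>F t in at_top. dist (norm (x t)) 0 < e"
      by (auto elim: eventually_mono)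
  qed
qed

text \<open>Banach's fixed point theorem for the averaged equation. Since \<open>q\<close> bounds
  the mass of \<open>\<kappa>\<close> at all times, the operator contracts in the supremum norm over
  the whole half-line, and the solution is global at once.\<close>

lemma solution_exists:
  assumes x0: "norm x0 < \<rho>"
  shows "\<exists>x. solution x0 x"
proof -
  \<comment> \<open>\<open>max 0 t\<close> freezes the operator at time \<open>0\<close> for
    negative \<open>t\<close>, so that it acts on bounded continuous functions on the whole
    line.\<close>
  define \<Phi> where "\<Phi> y t = (1 - R (max 0 t)) *\<^sub>R x0 + conv \<mu> y (max 0 t) + conv p (\<lambda>s. f (y s)) (max 0 t)" for y t
  define S where "S = PiC UNIV (\<lambda>_::real. cball (0::'a) \<rho>)"
  have inS: "y \<in> S \<longleftrightarrow> (\<forall>t. norm (apply_bcontfun y t) \<le> \<rho>)" for y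
    by (auto simp: S_def mem_PiC_iff Pi_iff)
  have fc: "continuous_on UNIV (\<lambda>s. f (y s))" if "continuous_on UNIV y" for y :: "real \<Rightarrow> 'a"
    by (rule continuous_on_compose2[OF f_cont that subset_UNIV])
  have Rc: "continuous_on {0..} R"
    using continuous_on_conv[OF \<mu> continuous_on_const[of _ "1::real"]] by (simp add: conv_const[OF \<mu>])
  have \<Phi>c: "continuous_on UNIV (\<Phi> y)" if y: "continuous_on UNIV y" for y
    unfolding \<Phi>_def
    by (intro continuous_intros continuous_on_compose2[OF Rc] continuous_on_compose2[OF continuous_on_conv[OF \<mu> y]]
        continuous_on_compose2[OF continuous_on_conv[OF p fc[OF y]]]) auto
  have \<Phi>b: "norm (\<Phi> (apply_bcontfun y) t) \<le> \<rho>" if y: "y \<in> S" for y t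
  proof -
    let ?t = "max 0 t"
    have "norm (\<Phi> (apply_bcontfun y) t) \<le> norm ((1 - R ?t) *\<^sub>R x0) + norm (conv \<mu> y ?t + conv p (\<lambda>s. f (y s)) ?t)"
      unfolding \<Phi>_def add.assoc by (rule norm_triangle_ineq)
    moreover have "norm (conv \<mu> y ?t + conv p (\<lambda>s. f (y s)) ?t) \<le> conv \<kappa> (\<lambda>s. norm (y s)) ?t"
      using y by (intro norm_averaged_le) (auto simp: inS)
    moreover have "conv \<kappa> (\<lambda>s. norm (y s)) ?t \<le> integral {0..?t} \<kappa> * \<rho>"
      using y by (intro conv_\<kappa>_le continuous_on_norm) (auto simp: inS)
    moreover have "integral {0..?t} \<kappa> * \<rho> \<le> R ?t * \<rho>"
      using \<kappa>_integral_le(1) \<rho> by (intro mult_right_mono) auto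
    moreover have "norm ((1 - R ?t) *\<^sub>R x0) \<le> (1 - R ?t) * \<rho>"
      using R_less_1[of ?t] x0 by (auto intro!: mult_left_mono)
    ultimately show ?thesis by (simp add: left_diff_distrib)
  qed
  have \<Phi>B: "apply_bcontfun (Bcontfun (\<Phi> (apply_bcontfun y))) = \<Phi> (apply_bcontfun y)" if "y \<in> S" for y
    using \<Phi>c[of y] \<Phi>b[OF that] by (intro Bcontfun_inverse) (auto simp: bcontfun_def bounded_iff)
  have "\<exists>!y. y \<in> S \<and> Bcontfun (\<Phi> (apply_bcontfun y)) = y"
  proof (rule Banach_fix[OF _ _ q_nonneg q_less_1])
    show "complete S" unfolding S_def complete_eq_closed by (intro closed_PiC) auto
    show "S \<noteq> {}" using \<rho> inS[of "const_bcontfun 0"] by (auto simp: const_bcontfun.rep_eq)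
    show "(\<lambda>y. Bcontfun (\<Phi> (apply_bcontfun y))) ` S \<subseteq> S"
      using \<Phi>b by (auto simp: inS \<Phi>B)
    show "dist (Bcontfun (\<Phi> (apply_bcontfun y))) (Bcontfun (\<Phi> (apply_bcontfun z))) \<le> q * dist y z" if "y \<in> S" "z \<in> S" for y z
    proof (rule dist_bound, unfold \<Phi>B[OF that(1)] \<Phi>B[OF that(2)])
      fix t :: real
      let ?t = "max 0 t"
      have eq: "\<Phi> (apply_bcontfun y) t - \<Phi> (apply_bcontfun z) t = conv \<mu> y ?t - conv \<mu> z ?t + (conv p (\<lambda>s. f (y s)) ?t - conv p (\<lambda>s. f (z s)) ?t)"
        by (simp add: \<Phi>_def)
      have "norm (\<Phi> (apply_bcontfun y) t - \<Phi> (apply_bcontfun z) t) \<le> conv \<kappa> (\<lambda>s. norm (y s - z s)) ?t"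
        unfolding eq using that by (intro conv_step_bound) (auto simp: inS)
      moreover have "conv \<kappa> (\<lambda>s. norm (y s - z s)) ?t \<le> integral {0..?t} \<kappa> * dist y z"
        using dist_bounded[of y _ z]
        by (intro conv_\<kappa>_le continuous_on_norm continuous_on_diff) (auto simp: dist_norm)
      moreover have "integral {0..?t} \<kappa> * dist y z \<le> q * dist y z"
        using \<kappa>_integral_le(2) by (intro mult_right_mono) auto
      ultimately show "dist (\<Phi> (apply_bcontfun y) t) (\<Phi> (apply_bcontfun z) t) \<le> q * dist y z" by (simp add: dist_norm)
    qed
  qed
  then obtain y where y: "y \<in> S" "Bcontfun (\<Phi> (apply_bcontfun y)) = y" by auto
  have eq: "apply_bcontfun y s = \<Phi> (apply_bcontfun y) s" for s
    using \<Phi>B[OF y(1)] unfolding y(2) by (rule fun_cong)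
  have "y s = (1 - R s) *\<^sub>R x0 + conv \<mu> y s + conv p (\<lambda>s. f (y s)) s" if "s \<ge> 0" for s
    using eq[of s] unfolding \<Phi>_def max_absorb2[OF that] .
  then have "y t = x0 + conv k (\<lambda>s. f (y s)) t" if "t \<ge> 0" for t
    using that by (intro volterra_of_averaged fc) auto
  then have "y t = x0 + RL_integral \<alpha> (\<lambda>s. f (y s)) t" if "t \<ge> 0" for t
    unfolding RL_integral_eq_conv[OF that \<alpha>(1)] using that by blast
  then show ?thesis
    unfolding caputo_ivp_solution_def by (intro exI[of _ "apply_bcontfun y"]) auto
qed

lemma locally_asymptotically_stable: "locally_asymptotically_stable \<alpha> f 0"
  unfolding locally_asymptotically_stable_def
proof (intro conjI)
  show "equilibrium_state f 0" by (simp add: equilibrium_state_def f_0)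
  show "lyapunov_stable \<alpha> f 0"
    unfolding lyapunov_stable_def
  proof (intro allI impI)
    fix \<epsilon> :: real assume \<epsilon>: "\<epsilon> > 0"
    show "\<exists>\<delta>>0. \<forall>x0. norm (x0 - 0) < \<delta> \<longrightarrow> (\<exists>x. solution x0 x) \<and>
        (\<forall>x. solution x0 x \<longrightarrow> (\<forall>t\<ge>0. norm (x t - 0) < \<epsilon>))"
      using \<epsilon> \<rho> solution_exists solution_bounded[of _ _ "min \<rho> \<epsilon>"]
      by (intro exI[of _ "min \<rho> \<epsilon>"]) auto
  qed
  show "locally_attractive \<alpha> f 0"
    unfolding locally_attractive_def diff_0_right
    using \<rho> solution_exists solution_tendsto_0 by (intro exI[of _ \<rho>]) auto
qed

end

section \<open>Linearized stability\<close>

lemma conv_linear: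
  fixes g :: "real \<Rightarrow> 'a::euclidean_space" and T :: "'a \<Rightarrow> 'b::euclidean_space"
  assumes "volterra_kernel \<kappa>" "continuous_on UNIV g" "linear T"
  shows "conv \<kappa> (\<lambda>s. T (g s)) t = T (conv \<kappa> g t)"
  using integral_linear[OF conv_integrable[OF assms(1,2)], of T t t] assms(3)
  by (simp add: conv_def o_def linear_scale linear_conv_bounded_linear)

text \<open>The fractional integral commutes with linear maps. The lemma serves both to pass to new
  coordinates and to return from them.\<close>

lemma caputo_ivp_solution_affine:
  fixes f :: "'a::euclidean_space \<Rightarrow> 'a" and g :: "'b::euclidean_space \<Rightarrow> 'b"
  assumes \<alpha>: "0 < \<alpha>" and f: "continuous_on UNIV f" and T: "linear T"
    and g: "\<And>x. g (T (x - a)) = T (f x)" and sol: "caputo_ivp_solution \<alpha> f x0 x"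
  shows "caputo_ivp_solution \<alpha> g (T (x0 - a)) (\<lambda>t. T (x t - a))"
  unfolding caputo_ivp_solution_def
proof (intro conjI allI impI)
  have x: "continuous_on {0..} x" using sol by (simp add: caputo_ivp_solution_def)
  show "continuous_on {0..} (\<lambda>t. T (x t - a))"
    by (rule linear_continuous_on_compose[OF _ T]) (intro continuous_intros x)
  fix t :: real assume t: "t \<ge> 0"
  have y: "continuous_on UNIV (\<lambda>s. x (max 0 s))"
    by (rule continuous_on_compose2[OF x]) (auto intro!: continuous_intros)
  have h: "continuous_on UNIV (\<lambda>s. f (x (max 0 s)))"
    by (rule continuous_on_compose2[OF f y subset_UNIV])
  have "T (x t - a) = T (x0 - a) + T (RL_integral \<alpha> (\<lambda>s. f (x s)) t)"
    using sol t by (simp add: caputo_ivp_solution_def linear_add[OF T] linear_diff[OF T])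
  moreover have "RL_integral \<alpha> (\<lambda>s. f (x s)) t = conv (frac_kernel \<alpha>) (\<lambda>s. f (x (max 0 s))) t"
    unfolding RL_integral_eq_conv[OF t \<alpha>] by (rule conv_cong) auto
  moreover have "T (conv (frac_kernel \<alpha>) (\<lambda>s. f (x (max 0 s))) t)
      = conv (frac_kernel \<alpha>) (\<lambda>s. T (f (x (max 0 s)))) t"
    by (rule conv_linear[OF volterra_kernel_frac_kernel[OF \<alpha>] h T, symmetric])
  moreover have "conv (frac_kernel \<alpha>) (\<lambda>s. T (f (x (max 0 s)))) t = RL_integral \<alpha> (\<lambda>s. g (T (x s - a))) t"
    unfolding RL_integral_eq_conv[OF t \<alpha>] g by (rule conv_cong) auto
  ultimately show "T (x t - a) = T (x0 - a) + RL_integral \<alpha> (\<lambda>s. g (T (x s - a))) t"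
    by simp
qed

text \<open>Solutions are carried in both directions by \<open>z = L (x - xe)\<close>, and the
  operator bounds of \<open>L\<close> and of its inverse \<open>M\<close> convert the radii.\<close>

lemma locally_asymptotically_stable_linear_change:
  fixes f :: "'a::euclidean_space \<Rightarrow> 'a" and g :: "'b::euclidean_space \<Rightarrow> 'b"
  assumes \<alpha>: "0 < \<alpha>" and f: "continuous_on UNIV f"
    and L: "linear L" and M: "linear M" and M_L: "\<And>x. M (L x) = x" and L_M: "\<And>z. L (M z) = z"
    and g: "\<And>z. g z = L (f (xe + M z))"
    and stable: "locally_asymptotically_stable \<alpha> g 0"
  shows "locally_asymptotically_stable \<alpha> f xe"
proof -
  obtain CL where CL: "CL > 0" "\<And>x. norm (L x) \<le> norm x * CL"
    using bounded_linear.pos_bounded L linear_conv_bounded_linear by blast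
  obtain CM where CM: "CM > 0" "\<And>x. norm (M x) \<le> norm x * CM"
    using bounded_linear.pos_bounded M linear_conv_bounded_linear by blast
  have gc: "continuous_on UNIV g"
  proof -
    have "continuous_on UNIV (\<lambda>z. xe + M z)"
      by (intro continuous_intros linear_continuous_on_compose[OF _ M])
    then have "continuous_on UNIV (\<lambda>z. f (xe + M z))" by (rule continuous_on_compose2[OF f _ subset_UNIV])
    then have "continuous_on UNIV (\<lambda>z. L (f (xe + M z)))" by (rule linear_continuous_on_compose[OF _ L])
    moreover have "g = (\<lambda>z. L (f (xe + M z)))" by (rule ext) (rule g)
    ultimately show ?thesis by simp
  qed
  have to_g: "caputo_ivp_solution \<alpha> g (L (x0 - xe)) (\<lambda>t. L (x t - xe))"
    if "caputo_ivp_solution \<alpha> f x0 x" for x0 x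
    by (rule caputo_ivp_solution_affine[OF \<alpha> f L _ that]) (simp add: g M_L)
  have from_g: "\<exists>x. caputo_ivp_solution \<alpha> f x0 x"
    if ex: "\<exists>z. caputo_ivp_solution \<alpha> g (L (x0 - xe)) z" for x0
  proof -
    obtain z where z: "caputo_ivp_solution \<alpha> g (L (x0 - xe)) z" using ex by blast
    \<comment> \<open>The inverse change of coordinates \<open>xe + M z\<close> is brought into the
      form \<open>M (z - a)\<close> with \<open>a = - L xe\<close>.\<close>
    have "f (M (z - (- L xe))) = M (g z)" for z by (simp add: g M_L linear_add[OF M] add.commute)
    from caputo_ivp_solution_affine[OF \<alpha> gc M this z]
    have "caputo_ivp_solution \<alpha> f x0 (\<lambda>t. M (z t - (- L xe)))"
      by (simp add: linear_diff[OF L] M_L)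
    then show ?thesis by blast
  qed
  have small: "norm (L (x0 - xe)) < \<delta>" if "norm (x0 - xe) < \<delta> / CL" for x0 \<delta>
  proof -
    have "norm (x0 - xe) * CL < \<delta>" using that CL(1) by (simp add: pos_less_divide_eq)
    then show ?thesis using CL(2)[of "x0 - xe"] by linarith
  qed
  have bnd: "norm (x - xe) \<le> norm (L (x - xe)) * CM" for x
    using CM(2)[of "L (x - xe)"] by (simp add: M_L)
  have eq: "f xe = 0"
  proof -
    have "L (f xe) = 0"
      using stable g[of 0] by (simp add: locally_asymptotically_stable_def equilibrium_state_def linear_0[OF M])
    then show ?thesis using M_L[of "f xe"] linear_0[OF M] by simp
  qed
  have "lyapunov_stable \<alpha> f xe"
    unfolding lyapunov_stable_def
  proof (intro allI impI)
    fix \<epsilon> :: real assume \<epsilon>: "\<epsilon> > 0"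
    then have "\<epsilon> / CM > 0" using CM by simp
    then obtain \<delta> where \<delta>: "\<delta> > 0" "\<And>z0. norm z0 < \<delta> \<Longrightarrow> \<exists>z. caputo_ivp_solution \<alpha> g z0 z"
        "\<And>z0 z t. norm z0 < \<delta> \<Longrightarrow> caputo_ivp_solution \<alpha> g z0 z \<Longrightarrow> t \<ge> 0 \<Longrightarrow> norm (z t) < \<epsilon> / CM"
      using stable unfolding locally_asymptotically_stable_def lyapunov_stable_def by (metis diff_zero)
    show "\<exists>\<delta>>0. \<forall>x0. norm (x0 - xe) < \<delta> \<longrightarrow> (\<exists>x. caputo_ivp_solution \<alpha> f x0 x) \<and>
        (\<forall>x. caputo_ivp_solution \<alpha> f x0 x \<longrightarrow> (\<forall>t\<ge>0. norm (x t - xe) < \<epsilon>))"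
    proof (intro exI[of _ "\<delta> / CL"] conjI allI impI)
      fix x0 assume x0: "norm (x0 - xe) < \<delta> / CL"
      show "\<exists>x. caputo_ivp_solution \<alpha> f x0 x" by (intro from_g \<delta>(2) small x0)
      fix x t assume "caputo_ivp_solution \<alpha> f x0 x" "(t::real) \<ge> 0"
      then have "norm (L (x t - xe)) < \<epsilon> / CM" by (intro \<delta>(3)[OF small[OF x0] to_g])
      then have "norm (L (x t - xe)) * CM < \<epsilon>" using CM(1) by (simp add: pos_less_divide_eq)
      then show "norm (x t - xe) < \<epsilon>" using bnd[of "x t"] by linarith
    qed (use \<delta>(1) CL(1) in simp)
  qed
  moreover have "locally_attractive \<alpha> f xe"
  proof -
    obtain \<delta> where \<delta>: "\<delta> > 0" "\<And>z0. norm z0 < \<delta> \<Longrightarrow> \<exists>z. caputo_ivp_solution \<alpha> g z0 z"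
        "\<And>z0 z. norm z0 < \<delta> \<Longrightarrow> caputo_ivp_solution \<alpha> g z0 z \<Longrightarrow> ((\<lambda>t. norm (z t)) \<longlongrightarrow> 0) at_top"
      using stable unfolding locally_asymptotically_stable_def locally_attractive_def by (metis (no_types, lifting) diff_zero ext)
    show ?thesis unfolding locally_attractive_def
    proof (intro exI[of _ "\<delta> / CL"] conjI allI impI)
      fix x0 assume x0: "norm (x0 - xe) < \<delta> / CL"
      show "\<exists>x. caputo_ivp_solution \<alpha> f x0 x" by (intro from_g \<delta>(2) small x0)
      fix x assume "caputo_ivp_solution \<alpha> f x0 x"
      then have "((\<lambda>t. norm (L (x t - xe))) \<longlongrightarrow> 0) at_top" by (intro \<delta>(3)[OF small[OF x0] to_g])
      then have "((\<lambda>t. norm (L (x t - xe)) * CM) \<longlongrightarrow> 0 * CM) at_top" by (intro tendsto_intros)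
      then have lim: "((\<lambda>t. norm (L (x t - xe)) * CM) \<longlongrightarrow> 0) at_top" by simp
      show "((\<lambda>t. norm (x t - xe)) \<longlongrightarrow> 0) at_top"
        by (rule tendsto_sandwich[OF _ _ tendsto_const lim]) (simp_all add: bnd)
    qed (use \<delta>(1) CL(1) in simp)
  qed
  ultimately show ?thesis
    using eq by (simp add: locally_asymptotically_stable_def equilibrium_state_def)
qed

text \<open>For \<open>d = x - y\<close> and \<open>e = f x - f y\<close>, expanding the square
  gives \<open>(norm (d + h *\<^sub>R e))^2 \<le> (1 - 2 * h * c + h^2 * K^2) * (norm d)^2\<close>.
  For short steps the linear term wins, so Euler steps contract at rate
  \<open>c / 2\<close>.\<close>

lemma locally_asymptotically_stable_dissipative:
  fixes f :: "'a::euclidean_space \<Rightarrow> 'a"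
  assumes \<alpha>: "0 < \<alpha>" "\<alpha> < 1" and f: "continuous_on UNIV f" "f 0 = 0" and \<rho>: "\<rho> > 0" and c: "c > 0"
    and diss: "\<And>x y. x \<in> cball 0 \<rho> \<Longrightarrow> y \<in> cball 0 \<rho> \<Longrightarrow> (x - y) \<bullet> (f x - f y) \<le> - c * (norm (x - y))^2"
    and lip: "\<And>x y. x \<in> cball 0 \<rho> \<Longrightarrow> y \<in> cball 0 \<rho> \<Longrightarrow> norm (f x - f y) \<le> K * norm (x - y)"
  shows "locally_asymptotically_stable \<alpha> f 0"
proof -
  define K' where "K' = max K c"
  have K': "K' \<ge> c" "K' > 0" "K \<le> K'" using c by (auto simp: K'_def)
  \<comment> \<open>Up to this length the second-order term \<open>h^2 * K'^2\<close> is at most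
    \<open>h * c\<close>. As \<open>K'\<close> is at least \<open>c\<close>, it also gives
    \<open>c * \<tau> \<le> 1\<close>.\<close>
  define \<tau> where "\<tau> = c / K'^2"
  have \<tau>: "\<tau> > 0" using c K' by (simp add: \<tau>_def)
  have "c * c \<le> K' * K'" using K' c by (intro mult_mono) auto
  then have "c * c / (K' * K') \<le> 1" using K' by simp
  then have c\<tau>: "c / 2 * \<tau> \<le> 1" by (simp add: \<tau>_def power2_eq_square)
  obtain \<mu> p where k: "averaging_kernel \<alpha> \<tau> \<mu> p"
    by (rule averaging_kernel_exists[OF \<alpha> \<tau>])
  have contr: "norm (x + h *\<^sub>R f x - (y + h *\<^sub>R f y)) \<le> (1 - c / 2 * h) * norm (x - y)"
    if xy: "x \<in> cball 0 \<rho>" "y \<in> cball 0 \<rho>" and h: "0 \<le> h" "h \<le> \<tau>" for x y h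
  proof (rule power2_le_imp_le)
    define d where "d = x - y"
    define e where "e = f x - f y"
    have de: "d \<bullet> e \<le> - c * (norm d)^2" using diss[OF xy] by (simp add: d_def e_def)
    have "norm e \<le> K' * norm d"
      using lip[OF xy] mult_right_mono[OF K'(3) norm_ge_zero[of d]] unfolding d_def e_def by linarith
    then have e: "(norm e)^2 \<le> K'^2 * (norm d)^2"
      using power_mono[of "norm e" "K' * norm d" 2] by (simp add: power_mult_distrib)
    have "h * K'^2 \<le> \<tau> * K'^2" using h(2) by (intro mult_right_mono) auto
    then have hK: "h * K'^2 \<le> c" using K'(2) by (simp add: \<tau>_def)
    have "(norm (d + h *\<^sub>R e))^2 = (norm d)^2 + 2 * h * (d \<bullet> e) + h^2 * (norm e)^2"
      unfolding power2_norm_eq_inner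
      by (simp add: inner_add_left inner_add_right inner_commute[of e d] power2_eq_square algebra_simps del: power2_norm_eq_inner)
    moreover have "2 * h * (d \<bullet> e) \<le> - 2 * (h * c * (norm d)^2)"
    proof -
      have "h * (d \<bullet> e) \<le> h * (- c * (norm d)^2)" by (rule mult_left_mono[OF de h(1)])
      moreover have "h * (- c * (norm d)^2) = - (h * c * (norm d)^2)"
        by (simp only: mult_minus_left mult_minus_right mult.assoc)
      ultimately show ?thesis by linarith
    qed
    moreover have "h^2 * (norm e)^2 \<le> h^2 * (K'^2 * (norm d)^2)"
      by (rule mult_left_mono[OF e]) simp
    moreover have "h^2 * (K'^2 * (norm d)^2) \<le> h * c * (norm d)^2"
    proof -
      have "h^2 * (K'^2 * (norm d)^2) = h * (h * K'^2) * (norm d)^2" by (simp only: power2_eq_square mult_ac)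
      also have "\<dots> \<le> h * c * (norm d)^2" by (rule mult_right_mono[OF mult_left_mono[OF hK h(1)]]) simp
      finally show ?thesis .
    qed
    ultimately have sq: "(norm (d + h *\<^sub>R e))^2 \<le> (norm d)^2 - h * c * (norm d)^2" by linarith
    \<comment> \<open>Completing the square:
      \<open>1 - c * h \<le> (1 - c / 2 * h)^2\<close>.\<close>
    have "((1 - g) * N)^2 = N^2 - 2 * g * N^2 + (g * N)^2" for g N :: real
      by (simp add: power2_eq_square algebra_simps)
    from this[of "c / 2 * h" "norm d"] have "(norm d)^2 - h * c * (norm d)^2 \<le> ((1 - c / 2 * h) * norm d)^2"
      by simp
    with sq have "(norm (d + h *\<^sub>R e))^2 \<le> ((1 - c / 2 * h) * norm d)^2" by (rule order_trans)
    moreover have "d + h *\<^sub>R e = x + h *\<^sub>R f x - (y + h *\<^sub>R f y)"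
      unfolding d_def e_def scaleR_diff_right by (simp only: add_diff_add)
    ultimately show "(norm (x + h *\<^sub>R f x - (y + h *\<^sub>R f y)))^2 \<le> ((1 - c / 2 * h) * norm (x - y))^2"
      unfolding d_def by simp
    have "c / 2 * h \<le> c / 2 * \<tau>" using h c by (intro mult_left_mono) auto
    then show "0 \<le> (1 - c / 2 * h) * norm (x - y)" using c\<tau> by (intro mult_nonneg_nonneg) auto
  qed
  interpret averaging_kernel \<alpha> \<tau> \<mu> p by (rule k)
  interpret euler_contraction \<alpha> \<tau> \<mu> p f "c / 2" \<rho>
    by unfold_locales (use c in simp, fact c\<tau>, fact f(1), fact f(2), fact \<rho>, rule contr)
  show ?thesis by (rule locally_asymptotically_stable)
qed

text \<open>In the coordinates \<open>z = L (x - xe)\<close> the Lyapunov function becomes the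
  squared norm. Compactness of the unit sphere turns strict negativity into a uniform rate
  \<open>c\<close>, and near \<open>xe\<close> the remainder costs at most half of it. Since Euler
  steps are compared in pairs, the remainder is controlled for differences
  \<open>f x - f y\<close>.\<close>

theorem locally_asymptotically_stable_linearization:
  fixes f A L :: "'a::euclidean_space \<Rightarrow> 'a"
  assumes \<alpha>: "0 < \<alpha>" "\<alpha> < 1" and f: "continuous_on UNIV f" "f xe = 0"
    and A: "linear A" and L: "linear L"
    and neg: "\<And>d. d \<noteq> 0 \<Longrightarrow> L d \<bullet> L (A d) < 0"
    and strict: "\<And>\<eta>. \<eta> > 0 \<Longrightarrow> \<exists>\<rho>>0. \<forall>x\<in>cball xe \<rho>. \<forall>y\<in>cball xe \<rho>.
      norm (f x - f y - A (x - y)) \<le> \<eta> * norm (x - y)"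
  shows "locally_asymptotically_stable \<alpha> f xe"
proof -
  have "inj L"
  proof (rule linear_injective_0[OF L, THEN iffD2], intro allI impI)
    fix d assume "L d = 0" then show "d = 0" using neg[of d] by auto
  qed
  then obtain M where M: "linear M" "\<And>x. M (L x) = x" "\<And>z. L (M z) = z"
    using linear_injective_isomorphism[OF L] by blast
  define g where "g z = L (f (xe + M z))" for z
  define B where "B z = L (A (M z))" for z
  have B: "linear B" unfolding B_def[abs_def]
    using linear_compose[OF linear_compose[OF M(1) A] L] by (simp add: o_def)
  obtain CL where CL: "CL > 0" "\<And>x. norm (L x) \<le> norm x * CL"
    using bounded_linear.pos_bounded L linear_conv_bounded_linear by blast
  obtain CM where CM: "CM > 0" "\<And>x. norm (M x) \<le> norm x * CM"
    using bounded_linear.pos_bounded M(1) linear_conv_bounded_linear by blast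
  obtain CB where CB: "CB > 0" "\<And>x. norm (B x) \<le> norm x * CB"
    using bounded_linear.pos_bounded B linear_conv_bounded_linear by blast
  have gc: "continuous_on UNIV g"
  proof -
    have "continuous_on UNIV (\<lambda>z. xe + M z)"
      by (intro continuous_intros linear_continuous_on_compose[OF _ M(1)])
    then have "continuous_on UNIV (\<lambda>z. f (xe + M z))" by (rule continuous_on_compose2[OF f(1) _ subset_UNIV])
    then show ?thesis unfolding g_def[abs_def] by (rule linear_continuous_on_compose[OF _ L])
  qed
  have Bneg: "z \<bullet> B z < 0" if "z \<noteq> 0" for z
    using neg[of "M z"] that M(3) linear_0[OF L] unfolding B_def by metis
  obtain c where c: "c > 0" "\<And>z. z \<bullet> B z \<le> - c * (norm z)^2"
  proof -
    have "continuous_on (sphere 0 1) (\<lambda>z. z \<bullet> B z)"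
      by (intro continuous_intros linear_continuous_on_compose[OF _ B])
    then obtain u where u: "u \<in> sphere 0 1" "\<And>z. z \<in> sphere 0 1 \<Longrightarrow> z \<bullet> B z \<le> u \<bullet> B u"
      using continuous_attains_sup[of "sphere (0::'a) 1" "\<lambda>z. z \<bullet> B z"] by auto
    show ?thesis
    proof (rule that[of "- (u \<bullet> B u)"])
      show "- (u \<bullet> B u) > 0" using Bneg[of u] u(1) by (cases "u = 0") auto
      fix z
      show "z \<bullet> B z \<le> - (- (u \<bullet> B u)) * (norm z)^2"
      proof (cases "z = 0")
        case False
        define v where "v = z /\<^sub>R norm z"
        have z: "z = norm z *\<^sub>R v" using False by (simp add: v_def)
        have "v \<in> sphere 0 1" using False by (simp add: v_def)
        then have "v \<bullet> B v \<le> u \<bullet> B u" by (rule u(2))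
        then have "(norm z)^2 * (v \<bullet> B v) \<le> (norm z)^2 * (u \<bullet> B u)" by (intro mult_left_mono) auto
        moreover have "z \<bullet> B z = (norm z)^2 * (v \<bullet> B v)"
          by (subst z, subst (2) z) (simp add: linear_scale[OF B] power2_eq_square)
        ultimately show ?thesis by (simp add: mult.commute)
      qed (simp add: linear_0[OF B])
    qed
  qed
  \<comment> \<open>\<open>CL * CM\<close> bounds the growth of the remainder under the change of
    coordinates, so this choice makes it at most \<open>c / 2\<close>.\<close>
  define \<eta> where "\<eta> = c / (2 * CL * CM)"
  have \<eta>: "\<eta> > 0" using c CL CM by (simp add: \<eta>_def)
  obtain \<rho> where \<rho>: "\<rho> > 0" "\<And>x y. x \<in> cball xe \<rho> \<Longrightarrow> y \<in> cball xe \<rho> \<Longrightarrow>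
      norm (f x - f y - A (x - y)) \<le> \<eta> * norm (x - y)"
    using strict[OF \<eta>] by blast
  have inball: "xe + M z \<in> cball xe \<rho>" if "z \<in> cball 0 (\<rho> / CM)" for z
  proof -
    have "norm z * CM \<le> \<rho>" using that CM(1) by (simp add: pos_le_divide_eq)
    then show ?thesis using CM(2)[of z] by (simp add: dist_norm)
  qed
  have rem: "norm (g z - g w - B (z - w)) \<le> c / 2 * norm (z - w)"
    if "z \<in> cball 0 (\<rho> / CM)" "w \<in> cball 0 (\<rho> / CM)" for z w
  proof -
    define r where "r = f (xe + M z) - f (xe + M w) - A (M (z - w))"
    have "norm r \<le> \<eta> * norm (M (z - w))"
      using \<rho>(2)[OF inball[OF that(1)] inball[OF that(2)]] by (simp add: r_def linear_diff[OF M(1)])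
    moreover have "\<eta> * norm (M (z - w)) \<le> \<eta> * (norm (z - w) * CM)"
      using CM(2) \<eta> by (intro mult_left_mono) auto
    ultimately have "norm r * CL \<le> \<eta> * (norm (z - w) * CM) * CL"
      using CL(1) by (intro mult_right_mono) auto
    moreover have "\<eta> * (norm (z - w) * CM) * CL = c / 2 * norm (z - w)"
      using CL CM by (simp add: \<eta>_def field_simps)
    moreover have "g z - g w - B (z - w) = L r"
      by (simp add: g_def B_def r_def linear_diff[OF L])
    ultimately show ?thesis using CL(2)[of r] by simp
  qed
  have "locally_asymptotically_stable \<alpha> g 0"
  proof (rule locally_asymptotically_stable_dissipative[OF \<alpha> gc, of "\<rho> / CM" "c / 2" "CB + c / 2"])
    show "g 0 = 0" by (simp add: g_def linear_0[OF M(1)] linear_0[OF L] f(2))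
    show "\<rho> / CM > 0" "c / 2 > 0" using \<rho>(1) CM c by auto
    fix z w :: 'a assume zw: "z \<in> cball 0 (\<rho> / CM)" "w \<in> cball 0 (\<rho> / CM)"
    define d where "d = z - w"
    define r where "r = g z - g w - B d"
    have g: "g z - g w = B d + r" by (simp add: r_def)
    have r: "norm r \<le> c / 2 * norm d" using rem[OF zw] by (simp add: r_def d_def)
    have "d \<bullet> r \<le> norm d * norm r" by (rule norm_cauchy_schwarz)
    also have "\<dots> \<le> norm d * (c / 2 * norm d)" using r by (intro mult_left_mono) auto
    finally have "d \<bullet> r \<le> c / 2 * (norm d)^2" by (simp add: power2_eq_square mult_ac)
    then show "(z - w) \<bullet> (g z - g w) \<le> - (c / 2) * (norm (z - w))^2"
      using c(2)[of d] unfolding g d_def[symmetric] by (simp add: inner_add_right)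
    have "norm (B d + r) \<le> norm (B d) + norm r" by (rule norm_triangle_ineq)
    then show "norm (g z - g w) \<le> (CB + c / 2) * norm (z - w)"
      using CB(2)[of d] r unfolding g d_def[symmetric] by (simp add: algebra_simps)
  qed
  then show ?thesis
    by (rule locally_asymptotically_stable_linear_change[OF \<alpha>(1) f(1) L M, rotated]) (rule g_def)
qed

section \<open>The Maxwell--Bloch system\<close>

lemma exhaust_5:
  fixes x :: 5
  shows "x = 1 \<or> x = 2 \<or> x = 3 \<or> x = 4 \<or> x = 5"
proof (induct x)
  case (of_int z)
  then have "0 \<le> z" and "z < 5" by simp_all
  then have "z = 0 \<or> z = 1 \<or> z = 2 \<or> z = 3 \<or> z = 4" by arith
  then show ?case by auto
qed

lemma forall_5: "(\<forall>i::5. P i) \<longleftrightarrow> P 1 \<and> P 2 \<and> P 3 \<and> P 4 \<and> P 5"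
  by (metis exhaust_5)

lemma UNIV_5: "UNIV = {1::5, 2, 3, 4, 5}"
  using exhaust_5 by auto

lemma sum_5: "sum f (UNIV::5 set) = f 1 + f 2 + f 3 + f 4 + f 5"
  unfolding UNIV_5 by (simp add: ac_simps)

lemma vector_5 [simp]:
  "(vector [a, b, c, d, e] :: ('a::zero)^5) $ 1 = a"
  "(vector [a, b, c, d, e] :: ('a::zero)^5) $ 2 = b"
  "(vector [a, b, c, d, e] :: ('a::zero)^5) $ 3 = c"
  "(vector [a, b, c, d, e] :: ('a::zero)^5) $ 4 = d"
  "(vector [a, b, c, d, e] :: ('a::zero)^5) $ 5 = e"
  by (simp_all add: vector_def)

section \<open>The vector field and its linearization at the equilibrium\<close>

lemma maxwell_bloch_at_e1: "controlled_maxwell_bloch m n k1 k2 k3 k4 k5 (e1 m n) = 0"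
  by (simp add: controlled_maxwell_bloch_def e1_def vec_eq_iff forall_5)

lemma continuous_on_maxwell_bloch: "continuous_on S (controlled_maxwell_bloch m n k1 k2 k3 k4 k5)"
  unfolding continuous_on_def controlled_maxwell_bloch_def
proof (intro ballI vec_tendstoI)
  fix x :: "real^5" and i :: 5
  show "((\<lambda>x. vector [x$3 - k1 * (x$1 - m), x$4 - k2 * (x$2 - n), x$1 * x$5 - k3 * x$3,
      x$2 * x$5 - k4 * x$4, - (x$1 * x$3 + x$2 * x$4) - k5 * x$5] $ i) \<longlongrightarrow>
    (vector [x$3 - k1 * (x$1 - m), x$4 - k2 * (x$2 - n), x$1 * x$5 - k3 * x$3,
      x$2 * x$5 - k4 * x$4, - (x$1 * x$3 + x$2 * x$4) - k5 * x$5] :: real^5) $ i) (at x within S)"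
    using exhaust_5[of i] by (elim disjE) (simp_all, (intro tendsto_intros)+)
qed

text \<open>The Jacobian of the controlled system at \<open>e1 m n\<close>.\<close>

definition maxwell_bloch_linear ::
    "real \<Rightarrow> real \<Rightarrow> real \<Rightarrow> real \<Rightarrow> real \<Rightarrow> real \<Rightarrow> real \<Rightarrow> real^5 \<Rightarrow> real^5" where
  "maxwell_bloch_linear m n k1 k2 k3 k4 k5 d = vector
     [d$3 - k1 * d$1, d$4 - k2 * d$2, m * d$5 - k3 * d$3, n * d$5 - k4 * d$4,
      - (m * d$3 + n * d$4) - k5 * d$5]"

lemma linear_maxwell_bloch_linear: "linear (maxwell_bloch_linear m n k1 k2 k3 k4 k5)"
  by (rule linearI) (simp_all add: maxwell_bloch_linear_def vec_eq_iff forall_5 algebra_simps)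

text \<open>The nonlinear terms are quadratic, so the remainder is a sum of products of a component
  of \<open>x - y\<close> with one of \<open>x - e1 m n\<close> or \<open>y - e1 m n\<close>, each
  at most \<open>\<rho> * norm (x - y)\<close> in absolute value. There are eight such
  products.\<close>

lemma maxwell_bloch_strict_derivative:
  assumes x: "x \<in> cball (e1 m n) \<rho>" and y: "y \<in> cball (e1 m n) \<rho>"
  shows "norm (controlled_maxwell_bloch m n k1 k2 k3 k4 k5 x - controlled_maxwell_bloch m n k1 k2 k3 k4 k5 y
    - maxwell_bloch_linear m n k1 k2 k3 k4 k5 (x - y)) \<le> 8 * \<rho> * norm (x - y)"
proof -
  define d where "d = x - y"
  define u where "u = x - e1 m n"
  define v where "v = y - e1 m n"
  define r where "r = controlled_maxwell_bloch m n k1 k2 k3 k4 k5 x - controlled_maxwell_bloch m n k1 k2 k3 k4 k5 y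
    - maxwell_bloch_linear m n k1 k2 k3 k4 k5 (x - y)"
  have u: "\<bar>u $ i\<bar> \<le> \<rho>" for i
    using x component_le_norm_cart[of u i] by (simp add: u_def dist_norm norm_minus_commute)
  have v: "\<bar>v $ i\<bar> \<le> \<rho>" for i
    using y component_le_norm_cart[of v i] by (simp add: v_def dist_norm norm_minus_commute)
  have \<rho>: "0 \<le> \<rho>" using abs_ge_zero u by (rule order_trans)
  have p: "\<bar>u $ i * d $ j\<bar> \<le> \<rho> * norm d" "\<bar>d $ j * v $ i\<bar> \<le> \<rho> * norm d" for i j
    unfolding abs_mult mult.commute[of "\<bar>d $ j\<bar>"]
    by (rule mult_mono[OF u component_le_norm_cart \<rho> abs_ge_zero] mult_mono[OF v component_le_norm_cart \<rho> abs_ge_zero])+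
  have bilinear: "a * b - a' * b' - m' * (b - b') = (a - m') * (b - b') + (a - a') * b'" for a b a' b' m' :: real
    by (simp add: algebra_simps)
  have "r $ 1 = 0" "r $ 2 = 0"
    by (simp_all add: r_def controlled_maxwell_bloch_def maxwell_bloch_linear_def algebra_simps)
  moreover have "r $ 3 = u $ 1 * d $ 5 + d $ 1 * v $ 5" "r $ 4 = u $ 2 * d $ 5 + d $ 2 * v $ 5"
    using bilinear[of "x$1" "x$5" "y$1" "y$5" m] bilinear[of "x$2" "x$5" "y$2" "y$5" n]
    by (simp_all add: r_def controlled_maxwell_bloch_def maxwell_bloch_linear_def u_def v_def d_def e1_def
        right_diff_distrib)
  moreover have "r $ 5 = - (u $ 1 * d $ 3 + d $ 1 * v $ 3) - (u $ 2 * d $ 4 + d $ 2 * v $ 4)"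
    using bilinear[of "x$1" "x$3" "y$1" "y$3" m] bilinear[of "x$2" "x$4" "y$2" "y$4" n]
    by (simp add: r_def controlled_maxwell_bloch_def maxwell_bloch_linear_def u_def v_def d_def e1_def
        right_diff_distrib)
  moreover have "\<bar>u $ 1 * d $ 5 + d $ 1 * v $ 5\<bar> \<le> 2 * (\<rho> * norm d)"
    by (rule order_trans[OF abs_triangle_ineq]) (use p(1)[of 1 5] p(2)[of 1 5] in simp)
  moreover have "\<bar>u $ 2 * d $ 5 + d $ 2 * v $ 5\<bar> \<le> 2 * (\<rho> * norm d)"
    by (rule order_trans[OF abs_triangle_ineq]) (use p(1)[of 2 5] p(2)[of 2 5] in simp)
  moreover have "\<bar>- (u $ 1 * d $ 3 + d $ 1 * v $ 3) - (u $ 2 * d $ 4 + d $ 2 * v $ 4)\<bar> \<le> 4 * (\<rho> * norm d)"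
  proof -
    have "\<bar>- (a + b) - (c + e)\<bar> \<le> 4 * D" if "\<bar>a\<bar> \<le> D" "\<bar>b\<bar> \<le> D" "\<bar>c\<bar> \<le> D" "\<bar>e\<bar> \<le> D" for a b c e D :: real
      using that by linarith
    then show ?thesis using p by blast
  qed
  ultimately have r: "\<bar>r $ 1\<bar> = 0" "\<bar>r $ 2\<bar> = 0" "\<bar>r $ 3\<bar> \<le> 2 * (\<rho> * norm d)"
      "\<bar>r $ 4\<bar> \<le> 2 * (\<rho> * norm d)" "\<bar>r $ 5\<bar> \<le> 4 * (\<rho> * norm d)"
    by simp_all
  have "\<bar>r $ 1\<bar> + \<bar>r $ 2\<bar> + \<bar>r $ 3\<bar> + \<bar>r $ 4\<bar> + \<bar>r $ 5\<bar> \<le> 8 * (\<rho> * norm d)"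
    using add_mono[OF add_mono[OF r(3,4)] r(5)] unfolding r(1,2) by simp
  moreover have "norm r \<le> \<bar>r $ 1\<bar> + \<bar>r $ 2\<bar> + \<bar>r $ 3\<bar> + \<bar>r $ 4\<bar> + \<bar>r $ 5\<bar>"
    using norm_le_l1_cart[of r] by (simp add: sum_5)
  ultimately show ?thesis by (simp add: r_def d_def)
qed

text \<open>In the linearization the last three components form a closed system that drives the
  first two. \<open>dissipative\<close> bounds half the derivative of
  \<open>x^2 + y^2 + (z - \<epsilon> * (m * x + n * y))^2\<close> along that system. The first two
  components are added with a small weight \<open>\<eta>\<close>; their damping \<open>k1\<close>,
  \<open>k2\<close> and Young's inequality control the drive.\<close>

lemma maxwell_bloch_stable:
  fixes m n k1 k2 k3 k4 k5 \<epsilon> \<gamma> \<alpha> :: real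
  assumes \<alpha>: "0 < \<alpha>" "\<alpha> < 1" and k: "k1 > 0" "k2 > 0" and \<gamma>: "\<gamma> > 0"
    and dissipative: "\<And>x y z. x * (m * z - k3 * x) + y * (n * z - k4 * y)
      + (z - \<epsilon> * (m * x + n * y)) *
        (- (m * x + n * y) - k5 * z - \<epsilon> * (m * (m * z - k3 * x) + n * (n * z - k4 * y)))
      \<le> - \<gamma> * (x^2 + y^2 + z^2)"
  shows "locally_asymptotically_stable \<alpha> (controlled_maxwell_bloch m n k1 k2 k3 k4 k5) (e1 m n)"
proof -
  \<comment> \<open>Small enough that \<open>\<eta> / (2 * k1)\<close> and
    \<open>\<eta> / (2 * k2)\<close> are at most \<open>\<gamma> / 2\<close>, so that the drive uses
    up at most half of the dissipation.\<close>
  define \<eta> where "\<eta> = \<gamma> * min k1 k2"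
  have \<eta>: "\<eta> > 0" "\<eta> \<le> \<gamma> * k1" "\<eta> \<le> \<gamma> * k2" using k \<gamma> by (auto simp: \<eta>_def intro: mult_left_mono)
  define L :: "real^5 \<Rightarrow> real^5" where
    "L d = vector [sqrt \<eta> * d$1, sqrt \<eta> * d$2, d$3, d$4, d$5 - \<epsilon> * (m * d$3 + n * d$4)]" for d
  let ?A = "maxwell_bloch_linear m n k1 k2 k3 k4 k5"
  have L: "linear L"
    by (rule linearI) (simp_all add: L_def vec_eq_iff forall_5 algebra_simps)
  have young: "\<eta> * (p * (q - \<kappa> * p)) \<le> - (\<eta> * \<kappa> / 2) * p^2 + \<gamma> / 2 * q^2"
    if "\<kappa> > 0" "\<eta> \<le> \<gamma> * \<kappa>" for p q \<kappa>
  proof -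
    define g where "g = \<eta> / (2 * \<kappa>)"
    have g: "\<eta> = 2 * \<kappa> * g" "0 \<le> g" "g \<le> \<gamma> / 2"
      using that \<eta>(1) by (auto simp: g_def pos_divide_le_eq)
    have "g * (\<kappa> * p - q)^2 = 2 * \<kappa> * g * \<kappa> / 2 * p^2 - 2 * \<kappa> * g * (p * q) + g * q^2"
      by (simp add: power2_eq_square algebra_simps)
    moreover have "0 \<le> g * (\<kappa> * p - q)^2" using g(2) by simp
    moreover have "2 * \<kappa> * g * (p * (q - \<kappa> * p)) = 2 * \<kappa> * g * (p * q) - 2 * (2 * \<kappa> * g * \<kappa> / 2 * p^2)"
      by (simp add: power2_eq_square algebra_simps)
    moreover have "g * q^2 \<le> \<gamma> / 2 * q^2" by (rule mult_right_mono[OF g(3)]) simp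
    ultimately show ?thesis unfolding g(1) by linarith
  qed
  have neg: "L d \<bullet> L (?A d) < 0" if "d \<noteq> 0" for d
  proof -
    define x y z where "x = d$3" and "y = d$4" and "z = d$5"
    define Q where "Q = x * (m * z - k3 * x) + y * (n * z - k4 * y)
      + (z - \<epsilon> * (m * x + n * y)) *
        (- (m * x + n * y) - k5 * z - \<epsilon> * (m * (m * z - k3 * x) + n * (n * z - k4 * y)))"
    have sq: "sqrt \<eta> * a * (sqrt \<eta> * b) = \<eta> * (a * b)" for a b
    proof -
      have "sqrt \<eta> * a * (sqrt \<eta> * b) = sqrt \<eta> * sqrt \<eta> * (a * b)" by (simp only: mult_ac)
      then show ?thesis using \<eta>(1) by simp
    qed
    have "L d \<bullet> L (?A d) = \<eta> * (d$1 * (x - k1 * d$1)) + \<eta> * (d$2 * (y - k2 * d$2)) + Q"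
      unfolding inner_vec_def sum_5 by (simp add: L_def maxwell_bloch_linear_def sq x_def y_def z_def Q_def)
    moreover have "\<eta> * (d$1 * (x - k1 * d$1)) \<le> - (\<eta> * k1 / 2) * (d$1)^2 + \<gamma> / 2 * x^2"
      by (rule young[OF k(1) \<eta>(2)])
    moreover have "\<eta> * (d$2 * (y - k2 * d$2)) \<le> - (\<eta> * k2 / 2) * (d$2)^2 + \<gamma> / 2 * y^2"
      by (rule young[OF k(2) \<eta>(3)])
    moreover have "Q \<le> - \<gamma> * (x^2 + y^2 + z^2)" unfolding Q_def by (rule dissipative)
    moreover have "- \<gamma> * (x^2 + y^2 + z^2) = - (\<gamma> * x^2) - \<gamma> * y^2 - \<gamma> * z^2" by (simp add: algebra_simps)
    ultimately have le: "L d \<bullet> L (?A d) \<le> - (\<eta> * k1 / 2 * (d$1)^2 + \<eta> * k2 / 2 * (d$2)^2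
        + \<gamma> / 2 * x^2 + \<gamma> / 2 * y^2 + \<gamma> * z^2)" by simp
    have nn: "0 \<le> \<eta> * k1 / 2 * (d$1)^2" "0 \<le> \<eta> * k2 / 2 * (d$2)^2" "0 \<le> \<gamma> / 2 * x^2" "0 \<le> \<gamma> / 2 * y^2" "0 \<le> \<gamma> * z^2"
      using \<eta>(1) k \<gamma> by simp_all
    have "\<exists>i. d $ i \<noteq> 0" using that by (auto simp: vec_eq_iff)
    then have "d$1 \<noteq> 0 \<or> d$2 \<noteq> 0 \<or> x \<noteq> 0 \<or> y \<noteq> 0 \<or> z \<noteq> 0"
      unfolding x_def y_def z_def using forall_5[of "\<lambda>i. d $ i = 0"] by blast
    then have "0 < \<eta> * k1 / 2 * (d$1)^2 \<or> 0 < \<eta> * k2 / 2 * (d$2)^2 \<or> 0 < \<gamma> / 2 * x^2 \<or> 0 < \<gamma> / 2 * y^2 \<or> 0 < \<gamma> * z^2"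
      using \<eta>(1) k \<gamma> by (auto simp: zero_less_mult_iff)
    then show ?thesis using le nn by linarith
  qed
  show ?thesis
  proof (rule locally_asymptotically_stable_linearization[OF \<alpha> continuous_on_maxwell_bloch maxwell_bloch_at_e1
        linear_maxwell_bloch_linear L neg])
    fix \<zeta> :: real assume "\<zeta> > 0"
    then show "\<exists>\<rho>>0. \<forall>x\<in>cball (e1 m n) \<rho>. \<forall>y\<in>cball (e1 m n) \<rho>.
        norm (controlled_maxwell_bloch m n k1 k2 k3 k4 k5 x - controlled_maxwell_bloch m n k1 k2 k3 k4 k5 y
          - ?A (x - y)) \<le> \<zeta> * norm (x - y)"
      using maxwell_bloch_strict_derivative[where \<rho> = "\<zeta> / 8"] by (intro exI[of _ "\<zeta> / 8"]) simp
  qed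
qed

text \<open>With \<open>\<epsilon> = 0\<close> the couplings through \<open>m\<close> and
  \<open>n\<close> cancel by skew symmetry and only \<open>- k3 * x^2 - k4 * y^2 - k5 * z^2\<close>
  remains.\<close>

lemma maxwell_bloch_stable_positive:
  fixes m n k1 k2 k3 k4 k5 \<alpha> :: real
  assumes \<alpha>: "0 < \<alpha>" "\<alpha> < 1" and k: "k1 > 0" "k2 > 0" "k3 > 0" "k4 > 0" "k5 > 0"
  shows "locally_asymptotically_stable \<alpha> (controlled_maxwell_bloch m n k1 k2 k3 k4 k5) (e1 m n)"
proof (rule maxwell_bloch_stable[OF \<alpha> k(1,2), where \<epsilon> = 0])
  show "min k3 (min k4 k5) > 0" using k by simp
  fix x y z :: real
  have "min k3 (min k4 k5) * x^2 \<le> k3 * x^2" "min k3 (min k4 k5) * y^2 \<le> k4 * y^2"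
    "min k3 (min k4 k5) * z^2 \<le> k5 * z^2"
    by (intro mult_right_mono; simp)+
  moreover have "x * (m * z - k3 * x) + y * (n * z - k4 * y) + (z - 0 * (m * x + n * y)) *
        (- (m * x + n * y) - k5 * z - 0 * (m * (m * z - k3 * x) + n * (n * z - k4 * y)))
      = - (k3 * x^2) - k4 * y^2 - k5 * z^2"
    by (simp add: algebra_simps power2_eq_square)
  moreover have "- min k3 (min k4 k5) * (x^2 + y^2 + z^2)
      = - (min k3 (min k4 k5) * x^2) - min k3 (min k4 k5) * y^2 - min k3 (min k4 k5) * z^2"
    by (simp add: algebra_simps)
  ultimately show "x * (m * z - k3 * x) + y * (n * z - k4 * y) + (z - 0 * (m * x + n * y)) *
        (- (m * x + n * y) - k5 * z - 0 * (m * (m * z - k3 * x) + n * (n * z - k4 * y)))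
      \<le> - min k3 (min k4 k5) * (x^2 + y^2 + z^2)" by linarith
qed

text \<open>The plain energy dissipates nothing in \<open>z\<close>. With
  \<open>w = m * x + n * y\<close> and \<open>r = m^2 + n^2\<close>, the linear system gives
  \<open>w\<close> the derivative \<open>r * z - b * w\<close>, so the cross term in
  \<open>z - \<epsilon> * w\<close> contributes \<open>- \<epsilon> * r * z^2\<close>. The other new
  terms are of order \<open>\<epsilon>\<close> and are absorbed by the damping
  \<open>b\<close>.\<close>

lemma maxwell_bloch_stable_undamped_inversion:
  fixes m n k1 k2 b \<alpha> :: real
  assumes \<alpha>: "0 < \<alpha>" "\<alpha> < 1" and k: "k1 > 0" "k2 > 0" and b: "b > 0" and mn: "m^2 + n^2 \<noteq> 0"
  shows "locally_asymptotically_stable \<alpha> (controlled_maxwell_bloch m n k1 k2 b b 0) (e1 m n)"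
proof -
  define r where "r = m^2 + n^2"
  have r: "r > 0" using mn by (simp add: r_def sum_power2_gt_zero_iff)
  \<comment> \<open>\<open>\<epsilon> * C\<close> bounds the coefficient of \<open>x^2 + y^2\<close>
    in the error terms: \<open>(b + r)^2 / 2\<close> comes from Young's inequality, \<open>r\<close>
    from the bound for \<open>w^2\<close>. Then \<open>\<epsilon>\<close> is chosen to spend at most
    half of \<open>b\<close>.\<close>
  define C where "C = (b + r)^2 / 2 + r"
  have C: "C > 0" using r by (simp add: C_def add_nonneg_pos)
  define \<epsilon> where "\<epsilon> = min 1 (b / (2 * C))"
  have \<epsilon>: "0 < \<epsilon>" "\<epsilon> \<le> 1" using b C by (auto simp: \<epsilon>_def)
  have "\<epsilon> \<le> b / (2 * C)" by (simp add: \<epsilon>_def)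
  then have \<epsilon>C: "\<epsilon> * C \<le> b / 2" using C by (simp add: pos_le_divide_eq)
  \<comment> \<open>What is left of the two dampings when the errors have taken half of
    each.\<close>
  define \<gamma> where "\<gamma> = min (b / 2) (\<epsilon> * r / 2)"
  have \<gamma>: "\<gamma> > 0" "\<gamma> \<le> b / 2" "\<gamma> \<le> \<epsilon> * r / 2" using b \<epsilon> r by (auto simp: \<gamma>_def)
  show ?thesis
  proof (rule maxwell_bloch_stable[OF \<alpha> k \<gamma>(1), where \<epsilon> = \<epsilon>])
    fix x y z :: real
    define w where "w = m * x + n * y"
    define s where "s = x^2 + y^2"
    define c where "c = b + \<epsilon> * r"
    \<comment> \<open>Cauchy-Schwarz by way of Lagrange's identity.\<close>
    have ws: "w^2 \<le> r * s"
    proof -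
      have "r * s - w^2 = (m * y - n * x)^2"
        by (simp add: r_def s_def w_def power2_eq_square algebra_simps)
      then show ?thesis by (metis diff_ge_0_iff_ge zero_le_power2)
    qed
    have s: "s \<ge> 0" by (simp add: s_def)
    have c: "0 \<le> c" "c \<le> b + r" using b \<epsilon> r by (auto simp: c_def mult_left_le_one_le)
    then have c2: "c^2 \<le> (b + r)^2" by (intro power_mono)
    have Q: "x * (m * z - b * x) + y * (n * z - b * y)
      + (z - \<epsilon> * (m * x + n * y)) * (- (m * x + n * y) - 0 * z - \<epsilon> * (m * (m * z - b * x) + n * (n * z - b * y)))
      = - (b * s) - \<epsilon> * (r * z^2) + \<epsilon> * (c * (w * z)) + \<epsilon> * (1 - \<epsilon> * b) * w^2"
      by (simp add: r_def s_def w_def c_def power2_eq_square algebra_simps)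
    \<comment> \<open>Young's inequality, weighted so that only half of the gained
      \<open>r * z^2\<close> is spent.\<close>
    have young: "c * (w * z) \<le> r / 2 * z^2 + (b + r)^2 / 2 * s"
    proof -
      have "0 \<le> (r * z - c * w)^2 / (2 * r)" using r by simp
      also have "(r * z - c * w)^2 / (2 * r) = r / 2 * z^2 - c * (w * z) + c^2 * w^2 / (2 * r)"
        using r by (simp add: power2_diff power_mult_distrib field_simps) (simp add: power2_eq_square)
      finally have 1: "c * (w * z) \<le> r / 2 * z^2 + c^2 * w^2 / (2 * r)" by simp
      have "c^2 * w^2 \<le> (b + r)^2 * (r * s)" using c2 ws by (intro mult_mono) auto
      then have "c^2 * w^2 / (2 * r) \<le> (b + r)^2 * (r * s) / (2 * r)" using r by (intro divide_right_mono) auto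
      also have "\<dots> = (b + r)^2 / 2 * s" using r by simp
      finally show ?thesis using 1 by linarith
    qed
    have "\<epsilon> * (c * (w * z)) \<le> \<epsilon> * (r / 2 * z^2 + (b + r)^2 / 2 * s)"
      by (rule mult_left_mono[OF young]) (use \<epsilon> in simp)
    moreover have "\<epsilon> * (1 - \<epsilon> * b) * w^2 \<le> \<epsilon> * (r * s)"
    proof -
      have "(1 - \<epsilon> * b) * w^2 \<le> 1 * w^2" using \<epsilon> b by (intro mult_right_mono) auto
      then have "(1 - \<epsilon> * b) * w^2 \<le> r * s" using ws by simp
      then have "\<epsilon> * ((1 - \<epsilon> * b) * w^2) \<le> \<epsilon> * (r * s)" using \<epsilon>(1) by simp
      then show ?thesis by (simp only: mult.assoc)
    qed
    moreover have "\<epsilon> * (r / 2 * z^2 + (b + r)^2 / 2 * s) + \<epsilon> * (r * s) = \<epsilon> * r / 2 * z^2 + \<epsilon> * C * s"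
      by (simp add: C_def algebra_simps)
    moreover have "\<epsilon> * C * s \<le> b / 2 * s" by (rule mult_right_mono[OF \<epsilon>C s])
    moreover have "\<epsilon> * (r * z^2) = \<epsilon> * r / 2 * z^2 + \<epsilon> * r / 2 * z^2" by simp
    moreover have "\<gamma> * s \<le> b / 2 * s" by (rule mult_right_mono[OF \<gamma>(2) s])
    moreover have "\<gamma> * z^2 \<le> \<epsilon> * r / 2 * z^2" by (rule mult_right_mono[OF \<gamma>(3)]) simp
    moreover have "b * s = b / 2 * s + b / 2 * s" by simp
    moreover have "- \<gamma> * (x^2 + y^2 + z^2) = - (\<gamma> * s) - \<gamma> * z^2" by (simp add: s_def algebra_simps)
    ultimately show "x * (m * z - b * x) + y * (n * z - b * y)
      + (z - \<epsilon> * (m * x + n * y)) * (- (m * x + n * y) - 0 * z - \<epsilon> * (m * (m * z - b * x) + n * (n * z - b * y)))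
      \<le> - \<gamma> * (x^2 + y^2 + z^2)"
      unfolding Q by linarith
  qed
qed

theorem proposition4p4:
  fixes m n k1 k2 k3 k4 k5 a1 a2 a3 :: real
  assumes "m^2 + n^2 \<noteq> 0"
    and "k1 \<ge> 0" "k2 \<ge> 0" "k3 \<ge> 0" "k4 \<ge> 0" "k5 \<ge> 0"
    and "a1 = k3 + k4 + k5"
    and "a2 = k3 * k4 + k3 * k5 + k4 * k5 + m^2 + n^2"
    and "a3 = k3 * k4 * k5 + k3 * n^2 + k4 * m^2"
  shows
    "(k1 > 0 \<and> k2 > 0 \<and> k3 > 0 \<and> k4 > 0 \<and> k5 > 0 \<longrightarrow>
        (cubic_discriminant a1 a2 a3 > 0 \<longrightarrow>
          (\<forall>\<alpha>. 0 < \<alpha> \<and> \<alpha> < 1 \<longrightarrow>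
            locally_asymptotically_stable \<alpha> (controlled_maxwell_bloch m n k1 k2 k3 k4 k5) (e1 m n))) \<and>
        (cubic_discriminant a1 a2 a3 < 0 \<longrightarrow>
          (\<forall>\<alpha>. 0 < \<alpha> \<and> \<alpha> < 2 / 3 \<longrightarrow>
            locally_asymptotically_stable \<alpha> (controlled_maxwell_bloch m n k1 k2 k3 k4 k5) (e1 m n)))) \<and>
     (\<forall>b. k1 > 0 \<and> k2 > 0 \<and> k3 = b \<and> k4 = b \<and> b > 0 \<and> k5 = 0 \<longrightarrow>
        (b > 2 * sqrt (m^2 + n^2) \<longrightarrow>
          (\<forall>\<alpha>. 0 < \<alpha> \<and> \<alpha> < 1 \<longrightarrow>
            locally_asymptotically_stable \<alpha> (controlled_maxwell_bloch m n k1 k2 k3 k4 k5) (e1 m n))) \<and>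
        (0 < b \<and> b < 2 * sqrt (m^2 + n^2) \<longrightarrow>
          (\<forall>\<alpha>. 0 < \<alpha> \<and> \<alpha> < 2 / 3 \<longrightarrow>
            locally_asymptotically_stable \<alpha> (controlled_maxwell_bloch m n k1 k2 k3 k4 k5) (e1 m n))))"
  \<comment> \<open>Part (i) has positive damping throughout, part (ii) has \<open>k5 = 0\<close>
    and equal \<open>k3\<close>, \<open>k4\<close>; both ranges of orders lie between
    \<open>0\<close> and \<open>1\<close>.\<close>
  using assms(1) maxwell_bloch_stable_positive[of _ k1 k2 k3 k4 k5 m n]
    maxwell_bloch_stable_undamped_inversion[of _ k1 k2 _ m n]
  by (intro conjI allI impI) simp_all

end
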